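(* Let $0<q<1$ and $-1<\alpha<q$. Then the states $\vartheta_z^{q,\alpha}$ satisfy the resolution of the identity operator on $\mathcal{H}$: $$\mathbf{1}_{\mathcal{H}}=\int_{\mathbb{C}}|\vartheta_{z}^{q,\alpha}\rangle\langle\vartheta_{z}^{q,\alpha}|\;\mu_{q,\alpha}(d^2z),$$ with respect to the measure $$\mu_{q,\alpha}(d^2z)=\frac{1}{2\pi}\,\mathcal{N}_{q,\alpha}(r^2)\,\rho_{q,\alpha}(dr)\,\lambda_{[0,2\pi)}(d\theta),\qquad z=re^{i\theta},\ r\ge 0,\ \theta\in[0,2\pi),$$ where $\lambda_{[0,2\pi)}$ is the Lebesgue measure on $[0,2\pi)$ and $\rho_{q,\alpha}$ is the radial measure given by $$\rho_{q,\alpha}=(-\alpha,q;q)_{\infty}\sum_{n=0}^{\infty}\frac{q^n}{(q;q)_n}\,h_n(-\alpha q^{-1}|q)\,\delta_{(1-q)^{-1/2}q^{n/2}},$$ in terms of the Rogers-Szegő polynomials $h_n(z|q)$.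
   Context: Notation: $(a;q)_n=\prod_{k=0}^{n-1}(1-aq^k)$ for $0\le n\le\infty$, $(a_1,\dots,a_m;q)_n=\prod_i (a_i;q)_n$, $[n]_q=\frac{1-q^n}{1-q}$, $[n]_q!=\prod_{k=1}^n[k]_q$. $\delta_c$ is the Dirac mass at $c$. The Rogers-Szegő polynomials are $h_n(z|q)=\sum_{k=0}^n\frac{(q;q)_n}{(q;q)_k(q;q)_{n-k}}z^k$. Set $x_n^{q,\alpha}=(1+\alpha q^{n-1})[n]_q$, with generalized factorial $x_n^{q,\alpha}!=(-\alpha;q)_n[n]_q!$. $\mathcal{H}$ is a Hilbert space (a $q$-analog of the Fock space) with orthonormal basis $\{\varphi_n^{(q)}\}_{n\ge 0}$. The generalized $q$-deformed coherent states are $$\vartheta_z^{q,\alpha}=\left(\mathcal{N}_{q,\alpha}(z\bar z)\right)^{-1/2}\sum_{n=0}^\infty\frac{\bar z^n}{\sqrt{x_n^{q,\alpha}!}}\,\varphi_n^{(q)},$$ with normalization factor $$\mathcal{N}_{q,\alpha}(r^2)=\sum_{n=0}^\infty\frac{r^{2n}}{x_n^{q,\alpha}!}={}_2\phi_1\!\left(\begin{matrix}0,0\\-\alpha\end{matrix}\Big|q;r^2(1-q)\right),\qquad r^2=z\bar z,$$ where ${}_2\phi_1\!\left(\begin{matrix}a_1,a_2\\ b\end{matrix}\Big|q;t\right)=\sum_{k\ge0}\frac{(a_1,a_2;q)_k}{(b;q)_k}\frac{t^k}{(q;q)_k}$ is the basic hypergeometric series. The factor $\mathcal{N}_{q,\alpha}(z\bar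 z)$ is finite for $z\in\mathbb{C}_q=\{\zeta\in\mathbb{C}:(1-q)\zeta\bar\zeta<1\}$. $|u\rangle\langle u|$ denotes the rank-one operator $v\mapsto\langle u|v\rangle u$.
   Formalization: The integral is taken weakly; on the circle r=(1-q)^{-1/2}, which carries an atom of the radial measure but where the normalization factor is infinite and the states are undefined, the factor times the rank-one operator is read as its radial L^1 boundary value from inside the disc. *)

theory Defs
  imports "HOL-Analysis.Analysis"
begin

definition qpoch :: "real \<Rightarrow> real \<Rightarrow> nat \<Rightarrow> real" where
  "qpoch a q n = (\<Prod>k<n. 1 - a * q ^ k)"

definition qpoch_inf :: "real \<Rightarrow> real \<Rightarrow> real" where
  "qpoch_inf a q = (\<Prod>k. 1 - a * q ^ k)"

definition qbracket :: "real \<Rightarrow> nat \<Rightarrow> real" where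
  "qbracket q n = (1 - q ^ n) / (1 - q)"

definition qfact :: "real \<Rightarrow> nat \<Rightarrow> real" where
  "qfact q n = (\<Prod>k=1..n. qbracket q k)"

definition rogers_szego :: "nat \<Rightarrow> real \<Rightarrow> real \<Rightarrow> real" where
  "rogers_szego n z q = (\<Sum>k\<le>n. qpoch q q n / (qpoch q q k * qpoch q q (n - k)) * z ^ k)"

definition xnum :: "real \<Rightarrow> real \<Rightarrow> nat \<Rightarrow> real" where
  "xnum q \<alpha> n = (1 + \<alpha> * q powi (int n - 1)) * qbracket q n"

definition xfact :: "real \<Rightarrow> real \<Rightarrow> nat \<Rightarrow> real" where
  "xfact q \<alpha> n = qpoch (- \<alpha>) q n * qfact q n"

lemma xfact_eq_prod: "xfact q \<alpha> n = (\<Prod>k=1..n. xnum q \<alpha> k)"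
proof (induction n)
  case (Suc n)
  have "(\<Prod>k=1..Suc n. xnum q \<alpha> k) = xfact q \<alpha> n * xnum q \<alpha> (Suc n)"
    using Suc by simp
  also have "\<dots> = xfact q \<alpha> (Suc n)"
    by (simp add: xfact_def qpoch_def qfact_def xnum_def)
  finally show ?case ..
qed (simp add: xfact_def qpoch_def qfact_def)

lemma qpoch_pos:
  assumes "0 < q" "q < 1" "a < 1"
  shows "0 < qpoch a q n"
  unfolding qpoch_def
proof (rule prod_pos)
  fix k
  have p: "0 < q ^ k" "q ^ k \<le> 1" using assms by (auto simp: power_le_one)
  have "a * q ^ k < 1"
  proof (cases "a \<le> 0")
    case True
    then have "a * q ^ k \<le> 0" using p by (simp add: mult_nonpos_nonneg)
    then show ?thesis by simp
  next
    case False
    then have "a * q ^ k \<le> a * 1" using p by (intro mult_left_mono) auto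
    then show ?thesis using assms by simp
  qed
  then show "0 < 1 - a * q ^ k" by simp
qed

lemma xfact_alt:
  assumes "0 < q" "q < 1"
  shows "xfact q \<alpha> n = qpoch (- \<alpha>) q n * qpoch q q n / (1 - q) ^ n"
proof -
  have "qfact q n = qpoch q q n / (1 - q) ^ n"
    by (induction n) (use assms in \<open>auto simp: qfact_def qpoch_def qbracket_def\<close>)
  then show ?thesis by (simp add: xfact_def)
qed

lemma xfact_pos:
  assumes "0 < q" "q < 1" "-1 < \<alpha>"
  shows "0 < xfact q \<alpha> n"
  using assms by (simp add: xfact_alt qpoch_pos)

text \<open>
  The factor takes values in \<open>[0, \<infinity>]\<close> because the radial measure charges the circle
  \<open>(1 - q) |z|\<^sup>2 = 1\<close>, on which the series diverges.
\<close>

definition norm_factor :: "real \<Rightarrow> real \<Rightarrow> real \<Rightarrow> ennreal" where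
  "norm_factor q \<alpha> t = (\<Sum>n. ennreal (t ^ n / xfact q \<alpha> n))"

definition Cdisc :: "real \<Rightarrow> complex set" where
  "Cdisc q = {z. (1 - q) * (cmod z)\<^sup>2 < 1}"

definition Ccircle :: "real \<Rightarrow> complex set" where
  "Ccircle q = {z. (1 - q) * (cmod z)\<^sup>2 = 1}"

lemma norm_factor_finite:
  assumes q: "0 < q" "q < 1" "-1 < \<alpha>" and z: "z \<in> Cdisc q"
  shows "norm_factor q \<alpha> ((cmod z)\<^sup>2) < \<infinity>"
    and "norm_factor q \<alpha> ((cmod z)\<^sup>2) = ennreal (\<Sum>n. ((cmod z)\<^sup>2) ^ n / xfact q \<alpha> n)"
proof -
  define t where "t = (cmod z)\<^sup>2"
  define f where "f = (\<lambda>n. t ^ n / xfact q \<alpha> n)"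
  have t: "0 \<le> t" "(1 - q) * t < 1" using z by (auto simp: t_def Cdisc_def)
  have pos: "xfact q \<alpha> n > 0" for n using xfact_pos q by blast
  have nn: "0 \<le> f n" for n using pos[of n] t by (simp add: f_def)
  have step: "f (Suc n) = (1 - q) * t / ((1 + \<alpha> * q ^ n) * (1 - q * q ^ n)) * f n" for n
    using q by (simp add: f_def xfact_alt qpoch_def mult_ac)
  obtain c where c: "(1 - q) * t < c" "c < 1" using dense t by blast
  have qn: "(\<lambda>n. q ^ n) \<longlonglongrightarrow> 0" using q by (intro LIMSEQ_power_zero) auto
  have "(\<lambda>n. (1 - q) * t / ((1 + \<alpha> * q ^ n) * (1 - q * q ^ n)))
          \<longlonglongrightarrow> (1 - q) * t / ((1 + \<alpha> * 0) * (1 - q * 0))"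
    by (intro tendsto_intros qn) auto
  then have "eventually (\<lambda>n. (1 - q) * t / ((1 + \<alpha> * q ^ n) * (1 - q * q ^ n)) < c) sequentially"
    using c by (intro order_tendstoD(2)) auto
  then obtain N where N: "\<And>n. n \<ge> N \<Longrightarrow> (1 - q) * t / ((1 + \<alpha> * q ^ n) * (1 - q * q ^ n)) < c"
    by (auto simp: eventually_sequentially)
  have "summable f"
  proof (rule summable_ratio_test[of c N])
    fix n assume "n \<ge> N"
    then have "f (Suc n) \<le> c * f n"
      unfolding step using N[of n] nn[of n] by (intro mult_right_mono) auto
    then show "norm (f (Suc n)) \<le> c * norm (f n)" using nn by simp
  qed (use c in auto)
  then have eq: "norm_factor q \<alpha> t = ennreal (suminf f)"
    unfolding norm_factor_def f_def[symmetric]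
    using nn by (intro suminf_ennreal_eq) (auto intro: summable_sums simp: f_def)
  show "norm_factor q \<alpha> ((cmod z)\<^sup>2) = ennreal (\<Sum>n. ((cmod z)\<^sup>2) ^ n / xfact q \<alpha> n)"
    using eq by (simp add: t_def f_def)
  show "norm_factor q \<alpha> ((cmod z)\<^sup>2) < \<infinity>"
    using eq by (simp add: t_def)
qed

lemma norm_factor_infinite:
  assumes q: "0 < q" "q < 1" "-1 < \<alpha>" and z: "z \<in> Ccircle q"
  shows "norm_factor q \<alpha> ((cmod z)\<^sup>2) = \<infinity>"
proof (rule ccontr)
  assume fin: "norm_factor q \<alpha> ((cmod z)\<^sup>2) \<noteq> \<infinity>"
  have pos: "0 < qpoch (- \<alpha>) q n" "0 < qpoch q q n" for n using q by (auto intro!: qpoch_pos)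
  define f where "f = (\<lambda>n. ((cmod z)\<^sup>2) ^ n / xfact q \<alpha> n)"
  have f_eq: "f n = 1 / (qpoch (- \<alpha>) q n * qpoch q q n)" for n
  proof -
    have "((cmod z)\<^sup>2) ^ n * (1 - q) ^ n = ((1 - q) * (cmod z)\<^sup>2) ^ n"
      by (simp add: power_mult_distrib mult.commute)
    also have "\<dots> = 1" using z by (simp add: Ccircle_def)
    finally show ?thesis using q by (simp add: f_def xfact_alt)
  qed
  have ub: "qpoch (- \<alpha>) q n * qpoch q q n \<le> exp (1 / (1 - q) * \<bar>\<alpha>\<bar>)" for n
  proof -
    have "qpoch (- \<alpha>) q n \<le> (\<Prod>k<n. exp (q ^ k * \<bar>\<alpha>\<bar>))"
      unfolding qpoch_def
    proof (rule prod_mono)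
      fix k
      have p: "0 < q ^ k" "q ^ k \<le> 1" using q by (auto simp: power_le_one)
      have "\<alpha> * q ^ k \<le> q ^ k * \<bar>\<alpha>\<bar>" using p by (simp add: mult.commute)
      then have 1: "1 + \<alpha> * q ^ k \<le> exp (q ^ k * \<bar>\<alpha>\<bar>)"
        using exp_ge_add_one_self[of "q ^ k * \<bar>\<alpha>\<bar>"] by linarith
      have "- 1 \<le> \<alpha> * q ^ k"
      proof (cases "\<alpha> \<ge> 0")
        case True then show ?thesis using p by (smt (verit) mult_nonneg_nonneg)
      next
        case False
        then have "\<alpha> * 1 \<le> \<alpha> * q ^ k" using p by (intro mult_left_mono_neg) auto
        then show ?thesis using q by linarith
      qed
      with 1 show "0 \<le> 1 - - \<alpha> * q ^ k \<and> 1 - - \<alpha> * q ^ k \<le> exp (q ^ k * \<bar>\<alpha>\<bar>)" by simp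
    qed
    also have "\<dots> = exp ((\<Sum>k<n. q ^ k) * \<bar>\<alpha>\<bar>)"
      by (simp add: exp_sum sum_distrib_right)
    also have "\<dots> \<le> exp (1 / (1 - q) * \<bar>\<alpha>\<bar>)"
    proof -
      have "(\<Sum>k<n. q ^ k) = (1 - q ^ n) / (1 - q)" using q by (simp add: sum_gp_strict)
      also have "\<dots> \<le> 1 / (1 - q)" using q by (intro divide_right_mono) auto
      finally show ?thesis by (simp only: exp_le_cancel_iff) (intro mult_right_mono, auto)
    qed
    finally have A: "qpoch (- \<alpha>) q n \<le> exp (1 / (1 - q) * \<bar>\<alpha>\<bar>)" .
    have B: "qpoch q q n \<le> 1"
      unfolding qpoch_def
    proof (rule prod_le_1)
      fix k
      have "q ^ Suc k \<le> 1" using q by (intro power_le_one) auto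
      then show "0 \<le> 1 - q * q ^ k \<and> 1 - q * q ^ k \<le> 1" using q by simp
    qed
    show ?thesis using mult_mono[OF A B] pos[of n] by simp
  qed
  define c where "c = 1 / exp (1 / (1 - q) * \<bar>\<alpha>\<bar>)"
  have c: "0 < c" by (simp add: c_def)
  have lb: "c \<le> f n" for n
    unfolding f_eq c_def using ub[of n] pos[of n] by (intro divide_left_mono) auto
  have "summable f"
  proof (rule summable_suminf_not_top)
    show "0 \<le> f n" for n using lb[of n] c by linarith
    show "(\<Sum>n. ennreal (f n)) \<noteq> top" using fin by (simp add: norm_factor_def f_def)
  qed
  then have "f \<longlonglongrightarrow> 0" by (rule summable_LIMSEQ_zero)
  then have "eventually (\<lambda>n. f n < c) sequentially" using c by (intro order_tendstoD(2)) auto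
  then show False using lb by (auto simp: eventually_sequentially not_less[symmetric])
qed

definition node :: "real \<Rightarrow> nat \<Rightarrow> real" where
  "node q n = (1 - q) powr (- 1 / 2) * q powr (real n / 2)"

definition weight :: "real \<Rightarrow> real \<Rightarrow> nat \<Rightarrow> real" where
  "weight q \<alpha> n = qpoch_inf (- \<alpha>) q * qpoch_inf q q *
     (q ^ n / qpoch q q n * rogers_szego n (- \<alpha> * inverse q) q)"

definition rho :: "real \<Rightarrow> real \<Rightarrow> real measure" where
  "rho q \<alpha> = distr (density (count_space UNIV) (\<lambda>n. ennreal (weight q \<alpha> n))) borel (node q)"

lemma emeasure_rho:
  assumes "A \<in> sets borel"
  shows "emeasure (rho q \<alpha>) A =
    (\<Sum>n. ennreal (weight q \<alpha> n) * indicator A (node q n))"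
proof -
  have "emeasure (rho q \<alpha>) A =
      emeasure (density (count_space UNIV) (\<lambda>n. ennreal (weight q \<alpha> n))) (node q -` A)"
    using assms unfolding rho_def by (subst emeasure_distr) auto
  also have "\<dots> = (\<Sum>n. ennreal (weight q \<alpha> n) * indicator (node q -` A) n)"
    by (subst emeasure_density) (auto simp: nn_integral_count_space_nat)
  finally show ?thesis
    by (simp add: indicator_def)
qed

text \<open>
  The weights are nonnegative for \<open>-1 < \<alpha> < q\<close>, so nothing is lost by the conversion to
  \<^typ>\<open>ennreal\<close>.
\<close>

lemma rogers_szego_pos:
  assumes q: "0 < q" "q < 1" and x: "-1 < x"
  shows "0 < rogers_szego n x q"
proof -
  define P where "P = qpoch q q"
  define b where "b = (\<lambda>n k. P n / (P k * P (n - k)))"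
  define h where "h = (\<lambda>n y. \<Sum>k\<le>n. b n k * y ^ k)"
  have Ppos: "0 < P n" for n using q by (simp add: P_def qpoch_pos)
  have Pne: "P n \<noteq> 0" for n using Ppos[of n] by simp
  have P0: "P 0 = 1" by (simp add: P_def qpoch_def)
  have PS: "P (Suc n) = P n * (1 - q ^ Suc n)" for n by (simp add: P_def qpoch_def)
  have qne: "1 - q ^ Suc n \<noteq> 0" for n
    using power_Suc_less_one[of q n] q by simp
  have qle: "q ^ n \<le> 1" for n using q by (simp add: power_le_one)
  have b0: "b n 0 = 1" and bn: "b n n = 1" for n using Pne[of n] by (auto simp: b_def P0)
  have pascal: "b (Suc n) (Suc k) = b n k + q ^ Suc k * b n (Suc k)" if "k < n" for n k
  proof -
    obtain d where d: "n = Suc (k + d)" using \<open>k < n\<close> less_iff_Suc_add by auto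
    have e: "b (Suc n) (Suc k) = P n * (1 - q ^ Suc n) / (P k * (1 - q ^ Suc k) * (P d * (1 - q ^ Suc d)))"
      "b n k = P n / (P k * (P d * (1 - q ^ Suc d)))"
      "b n (Suc k) = P n / (P k * (1 - q ^ Suc k) * P d)"
      unfolding b_def by (simp_all add: d PS[symmetric] Suc_diff_le del: power_Suc)
    have "q ^ Suc n = q ^ Suc k * q ^ Suc d" by (simp add: d power_add)
    moreover have "p * (1 - u * v) / (a * (1 - u) * (c * (1 - v))) =
        p / (a * (c * (1 - v))) + u * (p / (a * (1 - u) * c))"
      if "a \<noteq> 0" "c \<noteq> 0" "1 - u \<noteq> 0" "1 - v \<noteq> 0" for p u v a c :: real
    proof -
      have "p / (a * (c * (1 - v))) = p * (1 - u) / (a * (1 - u) * (c * (1 - v)))"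
        "u * (p / (a * (1 - u) * c)) = p * (u * (1 - v)) / (a * (1 - u) * (c * (1 - v)))"
        using that by (simp_all add: mult_ac)
      then show ?thesis
        by (simp add: add_divide_distrib[symmetric] ring_distribs)
    qed
    ultimately show ?thesis
      unfolding e using Pne[of k] Pne[of d] qne[of k] qne[of d] by metis
  qed
  have down: "(1 - q ^ Suc k) * b (Suc n) (Suc k) = (1 - q ^ Suc n) * b n k" for n k
    using Pne[of k] qne[of k] by (simp add: b_def PS del: power_Suc)
  have h1: "h (Suc n) y = y * h n y + h n (q * y)" for n y
  proof -
    have "h (Suc n) y = 1 + (\<Sum>k\<le>n. b (Suc n) (Suc k) * y ^ Suc k)"
      by (simp add: h_def sum.atMost_Suc_shift b0 del: sum.atMost_Suc)
    also have "(\<Sum>k\<le>n. b (Suc n) (Suc k) * y ^ Suc k) =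
        (\<Sum>k<n. b (Suc n) (Suc k) * y ^ Suc k) + y ^ Suc n"
      by (simp add: lessThan_Suc_atMost[symmetric] bn)
    also have "(\<Sum>k<n. b (Suc n) (Suc k) * y ^ Suc k) =
        (\<Sum>k<n. b n k * y ^ Suc k) + (\<Sum>k<n. b n (Suc k) * (q * y) ^ Suc k)"
      unfolding sum.distrib[symmetric]
      by (intro sum.cong) (auto simp: pascal algebra_simps power_mult_distrib)
    also have "(\<Sum>k<n. b n k * y ^ Suc k) = y * h n y - y ^ Suc n"
      by (simp add: h_def lessThan_Suc_atMost[symmetric] bn sum_distrib_left algebra_simps)
    also have "(\<Sum>k<n. b n (Suc k) * (q * y) ^ Suc k) = h n (q * y) - 1"
      unfolding h_def by (subst sum.atMost_shift) (simp add: b0)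
    finally show ?thesis by simp
  qed
  have h2: "h (Suc n) y - h (Suc n) (q * y) = (1 - q ^ Suc n) * (y * h n y)" for n y
  proof -
    have "h (Suc n) y - h (Suc n) (q * y) =
        (\<Sum>k\<le>n. (1 - q ^ Suc k) * b (Suc n) (Suc k) * y ^ Suc k)"
      by (simp add: h_def sum.atMost_Suc_shift b0 sum_subtractf[symmetric]
            power_mult_distrib algebra_simps del: sum.atMost_Suc)
    also have "\<dots> = (1 - q ^ Suc n) * (y * h n y)"
      unfolding down by (simp add: h_def sum_distrib_left mult_ac)
    finally show ?thesis .
  qed
  have rec: "h (Suc (Suc n)) x = (1 + x) * h (Suc n) x - x * (1 - q ^ Suc n) * h n x" for n
    using h1[of "Suc n" x] h2[of n x] by (simp add: algebra_simps)
  have "0 < h n x"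
  proof (cases "0 \<le> x")
    case True
    have "0 < b n 0 * x ^ 0" by (simp add: b0)
    also have "\<dots> \<le> h n x"
      unfolding h_def
    proof (rule member_le_sum)
      fix k assume "k \<in> {..n} - {0}"
      show "0 \<le> b n k * x ^ k" using Ppos True by (simp add: b_def less_imp_le)
    qed auto
    finally show ?thesis .
  next
    case False
    have "0 < h n x \<and> 0 < h (Suc n) x"
    proof (induction n)
      case 0
      have "h 0 x = 1" "h (Suc 0) x = 1 + x"
        using b0[of 1] bn[of 1] by (simp_all add: h_def b0)
      then show ?case using x by simp
    next
      case (Suc n)
      have "0 \<le> (- x) * (1 - q ^ Suc n) * h n x"
        using False Suc qle[of "Suc n"] by (intro mult_nonneg_nonneg) auto
      moreover have "0 < (1 + x) * h (Suc n) x" using x Suc by simp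
      ultimately show ?case using Suc rec[of n] by simp
    qed
    then show ?thesis ..
  qed
  then show ?thesis by (simp add: h_def b_def P_def rogers_szego_def)
qed

lemma qpoch_inf_nonneg:
  assumes q: "0 < q" "q < 1" and a: "a < 1"
  shows "0 \<le> qpoch_inf a q"
proof -
  have ne: "a * q ^ k \<noteq> 1" for k
    using qpoch_pos[OF q a, of "Suc k"] by (auto simp: qpoch_def)
  have "summable (\<lambda>k. norm (- a * q ^ k))"
    using q by (simp add: abs_mult summable_mult summable_geometric)
  then have "convergent_prod (\<lambda>k. 1 + - a * q ^ k)"
    by (intro summable_imp_convergent_prod_real) (use ne in auto)
  then have "(\<lambda>n. \<Prod>k\<le>n. 1 - a * q ^ k) \<longlonglongrightarrow> qpoch_inf a q"
    unfolding qpoch_inf_def by (intro convergent_prod_LIMSEQ) simp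
  moreover have "0 \<le> (\<Prod>k\<le>n. 1 - a * q ^ k)" for n
    using qpoch_pos[OF q a, of "Suc n"] by (simp add: qpoch_def lessThan_Suc_atMost)
  ultimately show ?thesis by (intro LIMSEQ_le_const) auto
qed

lemma weight_nonneg:
  assumes "0 < q" "q < 1" "-1 < \<alpha>" "\<alpha> < q"
  shows "0 \<le> weight q \<alpha> n"
proof -
  have "-1 < - \<alpha> * inverse q" using assms by (simp add: field_simps)
  then have "0 < rogers_szego n (- \<alpha> * inverse q) q" using assms by (intro rogers_szego_pos)
  moreover have "0 < qpoch q q n" using assms by (simp add: qpoch_pos)
  ultimately show ?thesis
    unfolding weight_def using assms
    by (intro mult_nonneg_nonneg divide_nonneg_pos qpoch_inf_nonneg) auto
qed

definition planar :: "real \<Rightarrow> real \<Rightarrow> complex measure" where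
  "planar q \<alpha> = scale_measure (ennreal (1 / (2 * pi)))
     (distr (rho q \<alpha> \<Otimes>\<^sub>M restrict_space lborel {0..<2 * pi}) borel
       (\<lambda>(r, \<theta>). complex_of_real r * cis \<theta>))"

definition mu :: "real \<Rightarrow> real \<Rightarrow> complex measure" where
  "mu q \<alpha> = density (planar q \<alpha>) (\<lambda>z. norm_factor q \<alpha> ((cmod z)\<^sup>2))"

locale complex_hilbert_space = vector_space scaleC
  for scaleC :: "complex \<Rightarrow> 'h::banach \<Rightarrow> 'h" +
  fixes ip :: "'h \<Rightarrow> 'h \<Rightarrow> complex"
  assumes scale_of_real: "scaleC (complex_of_real r) x = r *\<^sub>R x"
    and ip_add_right: "ip x (y + z) = ip x y + ip x z"
    and ip_scale_right: "ip x (scaleC c y) = c * ip x y"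
    and ip_commute: "ip y x = cnj (ip x y)"
    and ip_self: "ip x x = complex_of_real ((norm x)\<^sup>2)"

definition orthonormal_basis ::
  "(complex \<Rightarrow> 'h::banach \<Rightarrow> 'h) \<Rightarrow> ('h \<Rightarrow> 'h \<Rightarrow> complex) \<Rightarrow> (nat \<Rightarrow> 'h) \<Rightarrow> bool" where
  "orthonormal_basis scaleC ip \<phi> \<longleftrightarrow>
     (\<forall>m n. ip (\<phi> m) (\<phi> n) = (if m = n then 1 else 0)) \<and>
     closure (module.span scaleC (range \<phi>)) = UNIV"

definition rank_one ::
  "(complex \<Rightarrow> 'h::banach \<Rightarrow> 'h) \<Rightarrow> ('h \<Rightarrow> 'h \<Rightarrow> complex) \<Rightarrow> 'h \<Rightarrow> 'h \<Rightarrow> 'h" where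
  "rank_one scaleC ip u = (\<lambda>v. scaleC (ip u v) u)"

definition coherent_state ::
  "(complex \<Rightarrow> 'h::banach \<Rightarrow> 'h) \<Rightarrow> (nat \<Rightarrow> 'h) \<Rightarrow> real \<Rightarrow> real \<Rightarrow> complex \<Rightarrow> 'h" where
  "coherent_state scaleC \<phi> q \<alpha> z =
     scaleC (complex_of_real (1 / sqrt (enn2real (norm_factor q \<alpha> ((cmod z)\<^sup>2)))))
       (\<Sum>n. scaleC (cnj z ^ n / complex_of_real (sqrt (xfact q \<alpha> n))) (\<phi> n))"

text \<open>
  The measure \<open>mu q \<alpha>\<close> is carried by \<open>Cdisc q \<union> Ccircle q\<close>. On the circle, which has positive
  \<open>planar\<close> measure because of the atom of \<open>rho\<close> at \<open>node q 0\<close>, the normalization factor is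
  infinite (lemma \<open>norm_factor_infinite\<close>) and the series of the coherent state diverges; only the
  product of the factor with the rank-one operator, in which the factor cancels, has a boundary
  value there.  So the integral against \<open>mu\<close> of a function \<open>f\<close> on \<open>Cdisc q\<close> is the ordinary one
  over the disc, and on the circle the product \<open>norm_factor * f\<close> is read as its radial boundary
  value \<open>g\<close> (limit in \<open>L\<^sup>1\<close> from inside the disc) and integrated against \<open>planar\<close>.
\<close>

definition has_mu_integral ::
  "real \<Rightarrow> real \<Rightarrow> (complex \<Rightarrow> complex) \<Rightarrow> complex \<Rightarrow> bool" where
  "has_mu_integral q \<alpha> f I \<longleftrightarrow>
     set_integrable (mu q \<alpha>) (Cdisc q) f \<and>
     (\<exists>g. set_integrable (planar q \<alpha>) (Ccircle q) g \<and>
        ((\<lambda>s. \<integral>\<^sup>+z\<in>Ccircle q. ennreal (cmod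
             (complex_of_real (enn2real (norm_factor q \<alpha> ((cmod (complex_of_real s * z))\<^sup>2)))
                * f (complex_of_real s * z) - g z)) \<partial>planar q \<alpha>) \<longlongrightarrow> 0) (at_left 1) \<and>
        I = (LINT z:Cdisc q|mu q \<alpha>. f z) + (LINT z:Ccircle q|planar q \<alpha>. g z))"

definition has_weak_mu_integral ::
  "('h \<Rightarrow> 'h \<Rightarrow> complex) \<Rightarrow> real \<Rightarrow> real \<Rightarrow> (complex \<Rightarrow> 'h \<Rightarrow> 'h) \<Rightarrow> ('h \<Rightarrow> 'h) \<Rightarrow> bool" where
  "has_weak_mu_integral ip q \<alpha> T A \<longleftrightarrow>
     (\<forall>u v. has_mu_integral q \<alpha> (\<lambda>z. ip u (T z v)) (ip u (A v)))"

end

theory Submission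
  imports Defs
begin

text \<open>
  Write \<open>m n\<close> for \<open>xfact q \<alpha> n\<close> and \<open>F v z = (\<Sum>n. ip (\<phi> n) v * z ^ n / sqrt (m n))\<close>.
  On the disc the normalization factor cancels, and the integrand becomes \<open>F v z * cnj (F u z)\<close>.
  Integrating out the angle makes the monomials orthogonal, and the generating function of the
  Rogers-Szego polynomials at \<open>q ^ (k + 1)\<close> shows that the radial measure has even moments \<open>m k\<close>.
  Hence the functions \<open>z ^ n / sqrt (m n)\<close> are orthonormal in \<open>L\<^sup>2\<close> of the closed disc, boundary
  circle included, and the products of partial sums of \<open>F v\<close> and \<open>cnj (F u)\<close> converge in \<open>L\<^sup>1\<close>
  to a function \<open>g\<close> whose integral is \<open>ip u v\<close> by Parseval. It agrees with \<open>F v * cnj (F u)\<close> inside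
  the disc. On the circle it is the radial boundary value, because the error of the partial
  sums is bounded uniformly in the radius.
\<close>

section \<open>Moments of the radial measure\<close>

text \<open>At the nodes an even power of the radius is geometric in \<open>n\<close> with ratio
  \<open>q ^ k\<close>; this is what turns the moments of the radial measure into values of a
  generating function.\<close>

lemma node_power_even:
  assumes "0 < q" "q < 1"
  shows "node q n ^ (2 * k) = q ^ (k * n) / (1 - q) ^ k"
proof -
  have "(node q n)\<^sup>2 = ((1 - q) powr (- 1 / 2))\<^sup>2 * (q powr (real n / 2))\<^sup>2"
    by (simp add: node_def power_mult_distrib)
  also have "((1 - q) powr (- 1 / 2))\<^sup>2 = inverse (1 - q)"
    using assms powr_half_sqrt[of "1 - q"] by (simp add: powr_minus power_inverse)
  also have "(q powr (real n / 2))\<^sup>2 = q ^ n"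
    using assms by (simp add: power2_eq_square powr_add[symmetric] powr_realpow)
  finally have "(node q n)\<^sup>2 = q ^ n / (1 - q)" by (simp add: field_simps)
  then have "node q n ^ (2 * k) = (q ^ n / (1 - q)) ^ k" by (simp only: power_mult)
  then show ?thesis by (simp add: power_divide flip: power_mult) (simp add: mult.commute)
qed

text \<open>A convergent infinite product without a zero factor has a nonzero value, and the partial
  products are positive, so the limit is positive.\<close>

lemma qpoch_LIMSEQ:
  assumes q: "0 < q" "q < 1" and a: "a < 1"
  shows "qpoch a q \<longlonglongrightarrow> qpoch_inf a q" and "0 < qpoch_inf a q"
proof -
  have ne: "a * q ^ k \<noteq> 1" for k
    using qpoch_pos[OF q a, of "Suc k"] by (auto simp: qpoch_def)
  have "summable (\<lambda>k. norm (- a * q ^ k))"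
    using q by (simp add: abs_mult summable_mult summable_geometric)
  then have "convergent_prod (\<lambda>k. 1 + - a * q ^ k)"
    by (intro summable_imp_convergent_prod_real) (use ne in auto)
  then have c: "convergent_prod (\<lambda>k. 1 - a * q ^ k)" by simp
  then have "(\<lambda>n. \<Prod>k\<le>n. 1 - a * q ^ k) \<longlonglongrightarrow> qpoch_inf a q"
    unfolding qpoch_inf_def by (rule convergent_prod_LIMSEQ)
  then have "(\<lambda>n. qpoch a q (Suc n)) \<longlonglongrightarrow> qpoch_inf a q"
    by (simp add: qpoch_def lessThan_Suc_atMost)
  then show "qpoch a q \<longlonglongrightarrow> qpoch_inf a q" by (rule LIMSEQ_imp_Suc)
  have "qpoch_inf a q \<noteq> 0"
    unfolding qpoch_inf_def using prodinf_nonzero[OF c] ne by simp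
  with qpoch_inf_nonneg[OF assms] show "0 < qpoch_inf a q" by simp
qed

text \<open>Used to cancel infinite products: the quotient of \<open>qpoch_inf a q\<close> by its
  shift is a finite q-Pochhammer symbol. The bound on the absolute value passes from
  \<open>a\<close> to \<open>a * q ^ k\<close>, so both products have positive factors.\<close>

lemma qpoch_inf_split:
  assumes q: "0 < q" "q < 1" and a: "\<bar>a\<bar> < 1"
  shows "qpoch_inf a q = qpoch a q k * qpoch_inf (a * q ^ k) q"
proof -
  have "\<bar>a * q ^ k\<bar> \<le> \<bar>a\<bar> * 1"
    unfolding abs_mult using q by (intro mult_left_mono) (auto simp: power_le_one)
  then have "a * q ^ k < 1" using a by linarith
  then have "(\<lambda>n. qpoch a q k * qpoch (a * q ^ k) q n) \<longlonglongrightarrow> qpoch a q k * qpoch_inf (a * q ^ k) q"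
    using q by (intro tendsto_intros qpoch_LIMSEQ)
  moreover have "qpoch a q k * qpoch (a * q ^ k) q n = qpoch a q (n + k)" for n
  proof -
    have "qpoch a q (k + n) = (\<Prod>i<k. 1 - a * q ^ i) * (\<Prod>i=k..<k+n. 1 - a * q ^ i)"
      unfolding qpoch_def atLeast0LessThan[symmetric] by (rule prod.atLeastLessThan_concat[symmetric]) auto
    also have "(\<Prod>i=k..<k+n. 1 - a * q ^ i) = qpoch (a * q ^ k) q n"
      using prod.shift_bounds_nat_ivl[of "\<lambda>i. 1 - a * q ^ i" 0 k n]
      by (simp add: qpoch_def atLeast0LessThan power_add mult_ac add.commute)
    finally show ?thesis by (simp add: qpoch_def add.commute)
  qed
  moreover have "(\<lambda>n. qpoch a q (n + k)) \<longlonglongrightarrow> qpoch_inf a q"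
    using a by (intro LIMSEQ_ignore_initial_segment qpoch_LIMSEQ q) simp
  ultimately show ?thesis using LIMSEQ_unique by fastforce
qed

text \<open>The denominators decrease to the positive limit \<open>qpoch_inf q q\<close>, so a
  geometric series dominates.\<close>

lemma summable_norm_q_exponential:
  assumes q: "0 < q" "q < 1" and t: "\<bar>t\<bar> < 1"
  shows "summable (\<lambda>n. norm (t ^ n / qpoch q q n))"
proof (rule summable_comparison_test')
  show "summable (\<lambda>n. \<bar>t\<bar> ^ n / qpoch_inf q q)"
    using t by (intro summable_divide summable_geometric) simp
  have "decseq (qpoch q q)"
  proof (rule decseq_SucI)
    fix n
    have "qpoch q q n * (1 - q * q ^ n) \<le> qpoch q q n * 1"
      using qpoch_pos[OF q q(2), of n] q by (intro mult_left_mono) auto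
    then show "qpoch q q (Suc n) \<le> qpoch q q n" by (simp add: qpoch_def)
  qed
  then have "qpoch_inf q q \<le> qpoch q q n" for n
    using qpoch_LIMSEQ(1)[OF q q(2)] by (rule decseq_ge)
  then show "norm (norm (t ^ n / qpoch q q n)) \<le> \<bar>t\<bar> ^ n / qpoch_inf q q" for n
    using qpoch_LIMSEQ(2)[OF q q(2)] qpoch_pos[OF q q(2), of n]
    by (auto simp: power_abs intro!: divide_left_mono)
qed

text \<open>
  The \<open>q\<close>-exponential \<open>e\<close> satisfies \<open>(1 - t) e(t) = e(q t)\<close>; iterate and use continuity at \<open>0\<close>.
\<close>

theorem q_exponential_sums:
  assumes q: "0 < q" "q < 1" and t: "\<bar>t\<bar> < 1"
  shows "(\<lambda>n. t ^ n / qpoch q q n) sums (1 / qpoch_inf t q)"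
proof -
  define e where "e = (\<lambda>x. \<Sum>n. (1 / qpoch q q n) * x ^ n)"
  have sm: "summable (\<lambda>n. (1 / qpoch q q n) * x ^ n)" if "\<bar>x\<bar> < 1" for x
    using summable_norm_cancel[OF summable_norm_q_exponential[OF q that]] by simp
  have step: "e x * (1 - x) = e (q * x)" if x: "\<bar>x\<bar> < 1" for x
  proof -
    have qx: "\<bar>q * x\<bar> < 1" using q x mult_strict_mono'[of q 1 "\<bar>x\<bar>" 1] by (simp add: abs_mult)
    have "e x - e (q * x) = (\<Sum>n. (1 / qpoch q q n) * x ^ n - (1 / qpoch q q n) * (q * x) ^ n)"
      unfolding e_def by (rule suminf_diff[OF sm[OF x] sm[OF qx]])
    \<comment> \<open>The terms of index 0 cancel; in the remaining ones the factor
      \<open>1 - q ^ (n + 1)\<close> cancels the last factor of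
      \<open>qpoch q q (Suc n)\<close>.\<close>
    also have "\<dots> = (\<Sum>n. (1 / qpoch q q (Suc n)) * x ^ Suc n - (1 / qpoch q q (Suc n)) * (q * x) ^ Suc n)"
      by (subst suminf_split_head) (intro summable_diff sm x qx, simp)
    also have "\<dots> = (\<Sum>n. x * ((1 / qpoch q q n) * x ^ n))"
    proof (rule suminf_cong)
      fix n
      have "1 - q * q ^ n \<noteq> 0" using power_Suc_less_one[of q n] q by simp
      moreover have "qpoch q q n \<noteq> 0" using qpoch_pos[OF q q(2), of n] by simp
      moreover have "qpoch q q (Suc n) = qpoch q q n * (1 - q * q ^ n)" by (simp add: qpoch_def)
      ultimately show "(1 / qpoch q q (Suc n)) * x ^ Suc n - (1 / qpoch q q (Suc n)) * (q * x) ^ Suc n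
          = x * ((1 / qpoch q q n) * x ^ n)"
        by (simp add: diff_divide_distrib[symmetric] power_mult_distrib) (simp add: field_simps)
    qed
    also have "\<dots> = x * e x" unfolding e_def by (rule suminf_mult[OF sm[OF x]])
    finally show ?thesis by (simp add: algebra_simps)
  qed
  have iter: "e t * qpoch t q n = e (t * q ^ n)" for n
  proof (induction n)
    case (Suc n)
    have "\<bar>t * q ^ n\<bar> \<le> \<bar>t\<bar> * 1"
      unfolding abs_mult using q by (intro mult_left_mono) (auto simp: power_le_one)
    then have "e (t * q ^ n) * (1 - t * q ^ n) = e (q * (t * q ^ n))" using t by (intro step) linarith
    moreover have "e t * qpoch t q (Suc n) = (e t * qpoch t q n) * (1 - t * q ^ n)"
      by (simp add: qpoch_def)
    ultimately show ?case using Suc by (simp add: mult_ac)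
  qed (simp add: qpoch_def)
  have "isCont e 0"
    unfolding e_def by (rule isCont_powser[of _ "1 / 2"]) (rule sm, auto)
  moreover have "(\<lambda>n. t * q ^ n) \<longlonglongrightarrow> t * 0" using q by (intro tendsto_intros LIMSEQ_power_zero) simp
  ultimately have "(\<lambda>n. e (t * q ^ n)) \<longlonglongrightarrow> e 0" using isCont_tendsto_compose[of 0 e] by simp
  moreover have "e 0 = 1" using powser_zero[of "\<lambda>n. 1 / qpoch q q n"] by (simp only: e_def) (simp add: qpoch_def)
  moreover have "(\<lambda>n. e t * qpoch t q n) \<longlonglongrightarrow> e t * qpoch_inf t q"
    using t by (intro tendsto_intros qpoch_LIMSEQ q) simp
  ultimately have "e t * qpoch_inf t q = 1" unfolding iter using LIMSEQ_unique by metis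
  moreover from this have "qpoch_inf t q \<noteq> 0" by auto
  ultimately have "e t = 1 / qpoch_inf t q" by (simp add: nonzero_eq_divide_eq)
  then show ?thesis using summable_sums[OF sm[OF t]] by (simp add: e_def)
qed

text \<open>The Rogers-Szego polynomial is a q-binomial sum, so the series is the Cauchy product of
  the q-exponentials at \<open>x * t\<close> and \<open>t\<close>.\<close>

lemma rogers_szego_generating_function:
  assumes q: "0 < q" "q < 1" and t: "\<bar>t\<bar> < 1" and xt: "\<bar>x * t\<bar> < 1"
  shows "(\<lambda>n. t ^ n / qpoch q q n * rogers_szego n x q) sums (1 / (qpoch_inf t q * qpoch_inf (x * t) q))"
proof -
  have "(\<lambda>n. \<Sum>i\<le>n. ((x * t) ^ i / qpoch q q i) * (t ^ (n - i) / qpoch q q (n - i))) sums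
      ((\<Sum>n. (x * t) ^ n / qpoch q q n) * (\<Sum>n. t ^ n / qpoch q q n))"
    by (intro Cauchy_product_sums summable_norm_q_exponential q t xt)
  also have "(\<Sum>n. (x * t) ^ n / qpoch q q n) * (\<Sum>n. t ^ n / qpoch q q n)
      = 1 / (qpoch_inf t q * qpoch_inf (x * t) q)"
    using q_exponential_sums[OF q t] q_exponential_sums[OF q xt] by (simp add: sums_iff)
  also have "(\<lambda>n. \<Sum>i\<le>n. ((x * t) ^ i / qpoch q q i) * (t ^ (n - i) / qpoch q q (n - i)))
      = (\<lambda>n. t ^ n / qpoch q q n * rogers_szego n x q)"
  proof
    fix n
    have "qpoch q q n \<noteq> 0" using qpoch_pos[OF q q(2), of n] by simp
    then have "((x * t) ^ i / qpoch q q i) * (t ^ (n - i) / qpoch q q (n - i)) =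
        t ^ n / qpoch q q n * (qpoch q q n / (qpoch q q i * qpoch q q (n - i)) * x ^ i)" if "i \<le> n" for i
      using that power_add[of t i "n - i"] by (simp add: power_mult_distrib)
    then show "(\<Sum>i\<le>n. ((x * t) ^ i / qpoch q q i) * (t ^ (n - i) / qpoch q q (n - i)))
        = t ^ n / qpoch q q n * rogers_szego n x q"
      unfolding rogers_szego_def sum_distrib_left by (intro sum.cong refl) simp
  qed
  finally show ?thesis .
qed

text \<open>The generating function at \<open>t = q ^ (k + 1)\<close> and
  \<open>x = - \<alpha> / q\<close>, where \<open>x * t = - \<alpha> * q ^ k\<close>, gives the
  reciprocals of the shifted infinite products. The prefactor of the weight completes them to
  \<open>qpoch (- \<alpha>) q k * qpoch q q k\<close>, and the nodes supply
  \<open>(1 - q) ^ k\<close> in the denominator.\<close>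

theorem weight_moments:
  assumes q: "0 < q" "q < 1" and \<alpha>: "-1 < \<alpha>" "\<alpha> < q"
  shows "(\<lambda>n. weight q \<alpha> n * node q n ^ (2 * k)) sums xfact q \<alpha> k"
proof -
  define t where "t = q * q ^ k"
  have "q * q ^ k \<le> q * 1" using q by (intro mult_left_mono) (auto simp: power_le_one)
  moreover have "0 < q * q ^ k" using q by simp
  ultimately have t: "\<bar>t\<bar> < 1" using q unfolding t_def by linarith
  have xt_eq: "(- \<alpha> * inverse q) * t = - \<alpha> * q ^ k" using q by (simp add: t_def)
  have a: "\<bar>- \<alpha>\<bar> < 1" using q \<alpha> by simp
  have "\<bar>- \<alpha> * q ^ k\<bar> \<le> \<bar>- \<alpha>\<bar> * 1"
    unfolding abs_mult using q by (intro mult_left_mono) (auto simp: power_le_one)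
  then have xt: "\<bar>- \<alpha> * q ^ k\<bar> < 1" using a by linarith
  define C where "C = qpoch_inf (- \<alpha>) q * qpoch_inf q q / (1 - q) ^ k"
  have "(\<lambda>n. C * (t ^ n / qpoch q q n * rogers_szego n (- \<alpha> * inverse q) q)) sums
      (C * (1 / (qpoch_inf t q * qpoch_inf (- \<alpha> * q ^ k) q)))"
    using rogers_szego_generating_function[OF q t, of "- \<alpha> * inverse q"] xt
    unfolding xt_eq by (intro sums_mult)
  moreover have "C * (1 / (qpoch_inf t q * qpoch_inf (- \<alpha> * q ^ k) q)) = xfact q \<alpha> k"
  proof -
    have "qpoch_inf t q \<noteq> 0" "qpoch_inf (- \<alpha> * q ^ k) q \<noteq> 0"
      using qpoch_LIMSEQ(2)[OF q, of t] qpoch_LIMSEQ(2)[OF q, of "- \<alpha> * q ^ k"] t xt unfolding abs_less_iff by linarith+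
    then show ?thesis
      using qpoch_inf_split[OF q a, of k] qpoch_inf_split[OF q, of q k] q(1)
      by (simp add: C_def xfact_alt[OF q] t_def abs_of_pos q(2))
  qed
  moreover have "C * (t ^ n / qpoch q q n * rogers_szego n (- \<alpha> * inverse q) q)
      = weight q \<alpha> n * node q n ^ (2 * k)" for n
  proof -
    have "t ^ n = q ^ n * q ^ (k * n)" by (simp add: t_def power_mult_distrib power_mult)
    then show ?thesis unfolding weight_def node_power_even[OF q] C_def by (simp add: mult_ac)
  qed
  ultimately show ?thesis by simp
qed

section \<open>Parseval in a complex Hilbert space\<close>

lemma mult_cnj_eq_cmod_sq: "z * cnj z = (complex_of_real (cmod z))\<^sup>2"
  using complex_norm_square[of z] by simp

context complex_hilbert_space
begin

lemma ip_scale_left: "ip (scaleC c x) y = cnj c * ip x y"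
  by (subst (1 2) ip_commute) (simp add: ip_scale_right)

lemma ip_zero_right [simp]: "ip x 0 = 0"
  using ip_add_right[of x 0 0] by simp

lemma ip_minus_right: "ip x (- y) = - ip x y"
  using ip_add_right[of x y "- y"] by (simp add: add_eq_0_iff)

lemma ip_diff_right: "ip x (y - z) = ip x y - ip x z"
  using ip_add_right[of x y "- z"] by (simp add: ip_minus_right)

lemma ip_diff_left: "ip (y - z) x = ip y x - ip z x"
  by (subst (1 2 3) ip_commute) (simp add: ip_diff_right)

lemma ip_sum_right: "ip x (sum f A) = (\<Sum>i\<in>A. ip x (f i))"
  by (induction A rule: infinite_finite_induct) (auto simp: ip_add_right)

text \<open>Cauchy-Schwarz: the squared norm of \<open>x\<close> minus its orthogonal projection
  onto the line spanned by \<open>y\<close> is nonnegative; \<open>c\<close> is the coefficient of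
  that projection.\<close>

lemma cmod_ip_le: "cmod (ip x y) \<le> norm x * norm y"
proof (cases "y = 0")
  case False
  define c where "c = ip y x / complex_of_real ((norm y)\<^sup>2)"
  have xy: "ip x y = cnj (ip y x)" by (rule ip_commute)
  have ny: "complex_of_real ((norm y)\<^sup>2) \<noteq> 0" using False by simp
  have "complex_of_real ((norm (x - scaleC c y))\<^sup>2) =
      ip x x - cnj c * ip y x - c * cnj (ip y x) + cnj c * (c * ip y y)"
    unfolding ip_self[symmetric]
    by (simp add: ip_diff_left ip_diff_right ip_scale_left ip_scale_right xy algebra_simps)
  also have "c * ip y y = ip y x" using ny by (simp add: c_def ip_self)
  also have "ip x x - cnj c * ip y x - c * cnj (ip y x) + cnj c * ip y x
      = complex_of_real ((norm x)\<^sup>2 - (cmod (ip y x))\<^sup>2 / (norm y)\<^sup>2)"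
    using ny by (simp add: c_def ip_self mult_cnj_eq_cmod_sq)
  finally have "(norm (x - scaleC c y))\<^sup>2 = (norm x)\<^sup>2 - (cmod (ip y x))\<^sup>2 / (norm y)\<^sup>2"
    by (simp only: of_real_eq_iff)
  then have "(cmod (ip y x))\<^sup>2 / (norm y)\<^sup>2 \<le> (norm x)\<^sup>2" 
    using zero_le_power2[of "norm (x - scaleC c y)"] by linarith
  then have "(cmod (ip y x))\<^sup>2 \<le> (norm x * norm y)\<^sup>2"
    using False by (simp add: field_simps power_mult_distrib)
  then have "cmod (ip y x) \<le> norm x * norm y" by (rule power2_le_imp_le) simp
  then show ?thesis by (simp add: xy)
qed simp

text \<open>Boundedness comes from Cauchy-Schwarz; it lets limits and infinite sums pass through the
  inner product.\<close>

lemma bounded_linear_ip: "bounded_linear (ip x)"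
proof (rule bounded_linear_intro)
  show "ip x (r *\<^sub>R y) = r *\<^sub>R ip x y" for r y
    by (simp add: scale_of_real[symmetric] ip_scale_right scaleR_conv_of_real)
  show "norm (ip x y) \<le> norm y * norm x" for y using cmod_ip_le[of x y] by (simp add: mult.commute)
qed (rule ip_add_right)

lemma norm_scaleC: "norm (scaleC c x) = cmod c * norm x"
proof -
  have "complex_of_real ((norm (scaleC c x))\<^sup>2) = (c * cnj c) * ip x x"
    unfolding ip_self[symmetric] by (simp add: ip_scale_left ip_scale_right)
  also have "\<dots> = complex_of_real ((cmod c * norm x)\<^sup>2)"
    by (simp add: ip_self mult_cnj_eq_cmod_sq power_mult_distrib)
  finally have "(norm (scaleC c x))\<^sup>2 = (cmod c * norm x)\<^sup>2" by (simp only: of_real_eq_iff)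
  then show ?thesis by simp
qed

section \<open>Expansions in an orthonormal basis\<close>

context
  fixes \<phi> :: "nat \<Rightarrow> 'h"
  assumes basis: "orthonormal_basis scaleC ip \<phi>"
begin

lemma ip_basis: "ip (\<phi> m) (\<phi> n) = (if m = n then 1 else 0)"
  using basis by (simp add: orthonormal_basis_def)

lemma norm_basis: "norm (\<phi> n) = 1"
proof -
  have "complex_of_real ((norm (\<phi> n))\<^sup>2) = complex_of_real 1"
    unfolding ip_self[symmetric] by (simp add: ip_basis)
  then have "(norm (\<phi> n))\<^sup>2 = 1" by (simp only: of_real_eq_iff)
  then show ?thesis using norm_ge_zero[of "\<phi> n"] by (auto simp only: power2_eq_1_iff)
qed

abbreviation proj :: "nat \<Rightarrow> 'h \<Rightarrow> 'h" where
  "proj n v \<equiv> \<Sum>k<n. scaleC (ip (\<phi> k) v) (\<phi> k)"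

lemma ip_proj: "ip u (proj n v) = (\<Sum>k<n. ip (\<phi> k) v * cnj (ip (\<phi> k) u))"
  by (simp add: ip_sum_right ip_scale_right ip_commute[of "\<phi> _" u])

lemma norm_sq_proj: "(norm (proj n v))\<^sup>2 = (\<Sum>k<n. (cmod (ip (\<phi> k) v))\<^sup>2)"
proof -
  have c: "ip (\<phi> k) (proj n v) = ip (\<phi> k) v" if "k < n" for k
    using that by (simp add: ip_sum_right ip_scale_right ip_basis if_distrib[of "\<lambda>x. _ * x"] cong: if_cong)
  have "complex_of_real ((norm (proj n v))\<^sup>2) = complex_of_real (\<Sum>k<n. (cmod (ip (\<phi> k) v))\<^sup>2)"
    unfolding ip_self[symmetric] of_real_sum
    by (subst ip_proj, intro sum.cong refl) (simp only: c lessThan_iff complex_norm_square)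
  then show ?thesis by (simp only: of_real_eq_iff)
qed

text \<open>Follows by expanding the squared norm of \<open>v - proj n v\<close>, which is
  nonnegative. The bound does not depend on \<open>n\<close>, so it also yields the summability of
  the squared coefficients.\<close>

lemma bessel: "(\<Sum>k<n. (cmod (ip (\<phi> k) v))\<^sup>2) \<le> (norm v)\<^sup>2"
proof -
  let ?S = "\<Sum>k<n. (cmod (ip (\<phi> k) v))\<^sup>2"
  have a: "ip v (proj n v) = complex_of_real ?S"
    unfolding ip_proj by (simp add: mult_cnj_eq_cmod_sq)
  then have b: "ip (proj n v) v = complex_of_real ?S" by (subst ip_commute) simp
  have "complex_of_real ((norm (v - proj n v))\<^sup>2) = complex_of_real ((norm v)\<^sup>2 - ?S)"
    unfolding ip_self[symmetric]
    by (simp only: ip_diff_left ip_diff_right a b) (simp add: ip_self norm_sq_proj flip: of_real_power)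
  then have "(norm (v - proj n v))\<^sup>2 = (norm v)\<^sup>2 - ?S" by (simp only: of_real_eq_iff)
  then show ?thesis using zero_le_power2[of "norm (v - proj n v)"] by linarith
qed

lemma norm_proj_le: "norm (proj n v) \<le> norm v"
  by (rule power2_le_imp_le) (simp_all only: norm_sq_proj bessel norm_ge_zero)

lemma proj_diff: "proj n (v - w) = proj n v - proj n w"
  by (simp add: ip_diff_right scale_left_diff_distrib sum_subtractf)

text \<open>On the span the projections eventually act as the identity; since they are contractions
  and the span is dense, convergence extends to every vector.\<close>

lemma proj_tendsto: "(\<lambda>n. proj n v) \<longlonglongrightarrow> v"
proof -
  have span: "(\<lambda>n. proj n w) \<longlonglongrightarrow> w" if "w \<in> span (range \<phi>)" for w
    using that
  proof (induction rule: span_induct_alt)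
    case base
    show ?case by simp
  next
    case (step c x y)
    then obtain m where x: "x = \<phi> m" by auto
    have "\<forall>\<^sub>F n in sequentially. proj n x = x"
      using eventually_gt_at_top[of m]
    proof eventually_elim
      case (elim n)
      have "proj n x = (\<Sum>k<n. if k = m then \<phi> m else 0)"
        unfolding x by (intro sum.cong) (auto simp: ip_basis)
      then show ?case using elim x by simp
    qed
    then have "\<forall>\<^sub>F n in sequentially. scaleC c x + proj n y = proj n (scaleC c x + y)"
    proof eventually_elim
      case (elim n)
      have "proj n (scaleC c x + y) = scaleC c (proj n x) + proj n y"
        by (simp add: ip_add_right ip_scale_right scale_left_distrib sum.distrib scale_sum_right)
      then show ?case using elim by simp
    qed
    moreover have "(\<lambda>n. scaleC c x + proj n y) \<longlonglongrightarrow> scaleC c x + y"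
      by (intro tendsto_intros step)
    ultimately show ?case by (rule Lim_transform_eventually[rotated])
  qed
  show ?thesis
  proof (rule LIMSEQ_I)
    fix r :: real assume "0 < r"
    have "v \<in> closure (span (range \<phi>))" using basis by (simp add: orthonormal_basis_def)
    then obtain w where w: "w \<in> span (range \<phi>)" "dist w v < r / 3"
      using closure_approachable \<open>0 < r\<close> by (metis zero_less_divide_iff zero_less_numeral)
    obtain N where N: "\<And>n. n \<ge> N \<Longrightarrow> norm (proj n w - w) < r / 3"
      using LIMSEQ_D[OF span[OF w(1)], of "r / 3"] \<open>0 < r\<close> by auto
    have "norm (proj n v - v) < r" if "n \<ge> N" for n
    proof -
      \<comment> \<open>The first and third summands are small because \<open>w\<close> is close to
        \<open>v\<close>, the middle one because \<open>w\<close> lies in the span.\<close>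
      have eq: "proj n v - v = proj n (v - w) + (proj n w - w) + (w - v)" unfolding proj_diff by simp
      have "norm (proj n v - v) \<le> norm (proj n (v - w)) + norm (proj n w - w) + norm (w - v)"
        unfolding eq by (rule order_trans[OF norm_triangle_ineq add_right_mono[OF norm_triangle_ineq]])
      also have "\<dots> < r"
        using norm_proj_le[of "v - w" n] N[OF that] w(2)
        unfolding dist_norm norm_minus_commute[of v w] by linarith
      finally show ?thesis .
    qed
    then show "\<exists>N. \<forall>n\<ge>N. norm (proj n v - v) < r" by blast
  qed
qed

text \<open>The continuous functional \<open>ip u\<close> is applied to the expansion of
  \<open>v\<close>.\<close>

lemma parseval: "(\<lambda>k. ip (\<phi> k) v * cnj (ip (\<phi> k) u)) sums ip u v"
  unfolding sums_def ip_proj[symmetric]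
  by (rule bounded_linear.tendsto[OF bounded_linear_ip proj_tendsto])

lemma summable_basis_coefficients: "summable (\<lambda>k. (cmod (ip (\<phi> k) v))\<^sup>2)"
  using bessel by (intro bounded_imp_summable[of _ "(norm v)\<^sup>2"]) (auto simp del: sum.lessThan_Suc simp flip: lessThan_Suc_atMost)

end

end

section \<open>Products of partial sums of orthogonal expansions\<close>

text \<open>Fatou's lemma: a bound on the L1 distance of late members from \<open>k\<close> survives
  the passage to an almost everywhere limit.\<close>

lemma nn_integral_norm_diff_limit:
  fixes h :: "nat \<Rightarrow> 'a \<Rightarrow> 'b::{banach, second_countable_topology}"
  assumes [measurable]: "\<And>n. h n \<in> borel_measurable M" "k \<in> borel_measurable M"
    and lim: "AE x in M. (\<lambda>n. h n x) \<longlonglongrightarrow> g x"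
    and le: "\<And>n. N \<le> n \<Longrightarrow> (\<integral>\<^sup>+x. ennreal (norm (h n x - k x)) \<partial>M) \<le> C"
  shows "(\<integral>\<^sup>+x. ennreal (norm (g x - k x)) \<partial>M) \<le> C"
proof -
  have "(\<integral>\<^sup>+x. ennreal (norm (g x - k x)) \<partial>M)
      = (\<integral>\<^sup>+x. liminf (\<lambda>n. ennreal (norm (h n x - k x))) \<partial>M)"
  proof (rule nn_integral_cong_AE, use lim in eventually_elim)
    case (elim x)
    have "(\<lambda>n. ennreal (norm (h n x - k x))) \<longlonglongrightarrow> ennreal (norm (g x - k x))"
      by (intro tendsto_intros elim)
    then show ?case by (intro lim_imp_Liminf[symmetric]) auto
  qed
  also have "\<dots> \<le> liminf (\<lambda>n. \<integral>\<^sup>+x. ennreal (norm (h n x - k x)) \<partial>M)"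
    by (rule nn_integral_liminf) measurable
  also have "\<dots> \<le> limsup (\<lambda>n. \<integral>\<^sup>+x. ennreal (norm (h n x - k x)) \<partial>M)"
    by (rule Liminf_le_Limsup) simp
  also have "\<dots> \<le> C"
    by (rule Limsup_bounded) (use le in \<open>auto simp: eventually_sequentially\<close>)
  finally show ?thesis .
qed

text \<open>Young's inequality with weight \<open>r\<close> reduces the product to squares, and the
  choice of \<open>r\<close> balances the two terms. The shift by \<open>d\<close> keeps
  \<open>r\<close> defined and positive when \<open>A\<close> or \<open>B\<close> vanishes; it is
  removed at the end by letting \<open>d\<close> tend to 0.\<close>

lemma nn_integral_Cauchy_Schwarz:
  fixes f g :: "'a \<Rightarrow> complex"
  assumes [measurable]: "f \<in> borel_measurable M" "g \<in> borel_measurable M"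
    and f: "(\<integral>\<^sup>+x. ennreal ((cmod (f x))\<^sup>2) \<partial>M) \<le> ennreal (A\<^sup>2)" and A: "0 \<le> A"
    and g: "(\<integral>\<^sup>+x. ennreal ((cmod (g x))\<^sup>2) \<partial>M) \<le> ennreal (B\<^sup>2)" and B: "0 \<le> B"
  shows "(\<integral>\<^sup>+x. ennreal (cmod (f x * g x)) \<partial>M) \<le> ennreal (A * B)"
proof -
  have bound: "(\<integral>\<^sup>+x. ennreal (cmod (f x * g x)) \<partial>M) \<le> ennreal ((A + d) * (B + d))" if d: "0 < d" for d
  proof -
    define r where "r = (B + d) / (A + d)"
    have pos: "0 < A + d" "0 < B + d" "0 < r" using A B d by (auto simp: r_def)
    have "cmod (f x * g x) \<le> r / 2 * (cmod (f x))\<^sup>2 + 1 / (2 * r) * (cmod (g x))\<^sup>2" for x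
      using zero_le_power2[of "r * cmod (f x) - cmod (g x)"] pos
      by (simp add: norm_mult field_simps power2_eq_square)
    then have "(\<integral>\<^sup>+x. ennreal (cmod (f x * g x)) \<partial>M)
        \<le> (\<integral>\<^sup>+x. ennreal (r / 2) * ennreal ((cmod (f x))\<^sup>2) + ennreal (1 / (2 * r)) * ennreal ((cmod (g x))\<^sup>2) \<partial>M)"
      using pos by (intro nn_integral_mono) (simp flip: ennreal_mult ennreal_plus add: ennreal_leI)
    also have "\<dots> = ennreal (r / 2) * (\<integral>\<^sup>+x. ennreal ((cmod (f x))\<^sup>2) \<partial>M)
        + ennreal (1 / (2 * r)) * (\<integral>\<^sup>+x. ennreal ((cmod (g x))\<^sup>2) \<partial>M)"
      by (simp add: nn_integral_add nn_integral_cmult)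
    also have "\<dots> \<le> ennreal (r / 2) * ennreal ((A + d)\<^sup>2) + ennreal (1 / (2 * r)) * ennreal ((B + d)\<^sup>2)"
      using A B d
      by (intro add_mono mult_left_mono order_trans[OF f] order_trans[OF g] ennreal_leI power_mono) auto
    also have "\<dots> = ennreal (r / 2 * (A + d)\<^sup>2 + 1 / (2 * r) * (B + d)\<^sup>2)"
      using pos by (simp flip: ennreal_mult ennreal_plus)
    also have "r / 2 * (A + d)\<^sup>2 + 1 / (2 * r) * (B + d)\<^sup>2 = (A + d) * (B + d)"
    proof -
      have "v / u / 2 * u\<^sup>2 + 1 / (2 * (v / u)) * v\<^sup>2 = u * v" if "0 < u" "0 < v" for u v :: real
        using that by (simp add: field_simps power2_eq_square)
      from this[OF pos(1,2)] show ?thesis by (simp only: r_def)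
    qed
    finally show ?thesis .
  qed
  have "((\<lambda>d. ennreal ((A + d) * (B + d))) \<longlongrightarrow> ennreal ((A + 0) * (B + 0))) (at_right 0)"
    by (intro tendsto_intros)
  then have "(\<integral>\<^sup>+x. ennreal (cmod (f x * g x)) \<partial>M) \<le> ennreal ((A + 0) * (B + 0))"
    by (rule tendsto_lowerbound) (auto simp: eventually_at_right_less intro!: eventually_mono[OF eventually_at_right_less] bound)
  then show ?thesis by simp
qed

text \<open>The l2 norm of the sequence from index \<open>N\<close> on, written as a difference so
  that it tends to 0 by convergence of the partial sums; index 0 gives the full norm.\<close>

definition l2tail :: "(nat \<Rightarrow> complex) \<Rightarrow> nat \<Rightarrow> real" where
  "l2tail a N = sqrt ((\<Sum>k. (cmod (a k))\<^sup>2) - (\<Sum>k<N. (cmod (a k))\<^sup>2))"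

lemma l2tail_tendsto_0:
  assumes "summable (\<lambda>k. (cmod (a k))\<^sup>2)"
  shows "l2tail a \<longlonglongrightarrow> 0"
proof -
  have "l2tail a \<longlonglongrightarrow> sqrt ((\<Sum>k. (cmod (a k))\<^sup>2) - (\<Sum>k. (cmod (a k))\<^sup>2))"
    unfolding l2tail_def by (intro tendsto_intros summable_LIMSEQ assms)
  then show ?thesis by simp
qed

lemma l2tail_nonneg:
  assumes "summable (\<lambda>k. (cmod (a k))\<^sup>2)"
  shows "0 \<le> l2tail a N"
  using sum_le_suminf[OF assms, of "{..<N}"] by (simp add: l2tail_def)

lemma sum_le_l2tail:
  assumes "summable (\<lambda>k. (cmod (a k))\<^sup>2)"
  shows "(\<Sum>k\<in>{N..<n}. (cmod (a k))\<^sup>2) \<le> (l2tail a N)\<^sup>2"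
proof -
  have "(\<Sum>k<N. (cmod (a k))\<^sup>2) + (\<Sum>k\<in>{N..<n}. (cmod (a k))\<^sup>2) = (\<Sum>k\<in>{..<N} \<union> {N..<n}. (cmod (a k))\<^sup>2)"
    by (rule sum.union_disjoint[symmetric]) auto
  also have "\<dots> \<le> (\<Sum>k. (cmod (a k))\<^sup>2)" by (rule sum_le_suminf[OF assms]) auto
  finally show ?thesis
    using sum_le_suminf[OF assms, of "{..<N}"] by (simp add: l2tail_def)
qed

text \<open>
  Only upper bounds on the diagonal moments are required, so that restricting to the circle and
  shrinking the radius preserve the property and all estimates below are uniform in the radius.
\<close>

definition moment_dominated :: "'a measure \<Rightarrow> ('a \<Rightarrow> complex) \<Rightarrow> (nat \<Rightarrow> real) \<Rightarrow> bool" where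
  "moment_dominated M \<zeta> m \<longleftrightarrow> \<zeta> \<in> borel_measurable M \<and>
     (\<forall>j k. integrable M (\<lambda>x. \<zeta> x ^ j * cnj (\<zeta> x) ^ k)) \<and>
     (\<forall>j k. j \<noteq> k \<longrightarrow> (LINT x|M. \<zeta> x ^ j * cnj (\<zeta> x) ^ k) = 0) \<and>
     (\<forall>k. 0 < m k \<and> (LINT x|M. cmod (\<zeta> x) ^ (2 * k)) \<le> m k)"

text \<open>With \<open>m = xfact q \<alpha>\<close> and \<open>a k = ip (\<phi> k) v\<close> these
  are the partial sums of \<open>F v\<close>; the square roots normalize the monomials.\<close>

definition psum :: "(nat \<Rightarrow> real) \<Rightarrow> (nat \<Rightarrow> complex) \<Rightarrow> nat \<Rightarrow> complex \<Rightarrow> complex" where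
  "psum m a n z = (\<Sum>k<n. a k / complex_of_real (sqrt (m k)) * z ^ k)"

definition psum_prod ::
  "(nat \<Rightarrow> real) \<Rightarrow> (nat \<Rightarrow> complex) \<Rightarrow> (nat \<Rightarrow> complex) \<Rightarrow> nat \<Rightarrow> complex \<Rightarrow> complex" where
  "psum_prod m a b n z = psum m a n z * cnj (psum m b n z)"

text \<open>The two terms come from the splitting
  \<open>x y - x' y' = (x - x') y + x' (y - y')\<close>: the tail norm of the factor that changes
  times the full norm of the other factor.\<close>

definition prod_tail :: "(nat \<Rightarrow> complex) \<Rightarrow> (nat \<Rightarrow> complex) \<Rightarrow> nat \<Rightarrow> real" where
  "prod_tail a b N = l2tail a N * l2tail b 0 + l2tail a 0 * l2tail b N"

lemma prod_tail_tendsto_0: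
  assumes "summable (\<lambda>k. (cmod (a k))\<^sup>2)" "summable (\<lambda>k. (cmod (b k))\<^sup>2)"
  shows "prod_tail a b \<longlonglongrightarrow> 0"
proof -
  have "prod_tail a b \<longlonglongrightarrow> 0 * l2tail b 0 + l2tail a 0 * 0"
    unfolding prod_tail_def by (intro tendsto_intros l2tail_tendsto_0 assms)
  then show ?thesis by simp
qed

lemma continuous_psum_prod: "continuous_on A (psum_prod m a b n)"
  unfolding psum_prod_def psum_def by (intro continuous_intros)

text \<open>Orthogonality kills the off-diagonal terms of the double sum. An arbitrary finite index
  set serves both for initial segments and for blocks between two partial sums.\<close>

lemma moment_product_expansion:
  fixes c d :: "nat \<Rightarrow> complex"
  assumes M: "moment_dominated M \<zeta> m" and D: "finite D"
  shows "integrable M (\<lambda>x. (\<Sum>k\<in>D. c k * \<zeta> x ^ k) * cnj (\<Sum>k\<in>D. d k * \<zeta> x ^ k))"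
    and "(LINT x|M. (\<Sum>k\<in>D. c k * \<zeta> x ^ k) * cnj (\<Sum>k\<in>D. d k * \<zeta> x ^ k))
      = (\<Sum>k\<in>D. c k * cnj (d k) * complex_of_real (LINT x|M. cmod (\<zeta> x) ^ (2 * k)))"
proof -
  have int: "integrable M (\<lambda>x. \<zeta> x ^ j * cnj (\<zeta> x) ^ k)" for j k
    using M by (simp add: moment_dominated_def)
  have off: "(LINT x|M. \<zeta> x ^ j * cnj (\<zeta> x) ^ k) = 0" if "j \<noteq> k" for j k
    using M that by (simp add: moment_dominated_def)
  have diag: "(LINT x|M. \<zeta> x ^ k * cnj (\<zeta> x) ^ k) = complex_of_real (LINT x|M. cmod (\<zeta> x) ^ (2 * k))" for k
  proof -
    have "z ^ k * cnj z ^ k = complex_of_real (cmod z ^ (2 * k))" for z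
      unfolding power_mult of_real_power[of "(cmod z)\<^sup>2"] complex_norm_square by (rule power_mult_distrib[symmetric])
    then show ?thesis by (simp only: integral_complex_of_real)
  qed
  have eq: "(\<Sum>k\<in>D. c k * \<zeta> x ^ k) * cnj (\<Sum>k\<in>D. d k * \<zeta> x ^ k)
      = (\<Sum>j\<in>D. \<Sum>k\<in>D. (c j * cnj (d k)) * (\<zeta> x ^ j * cnj (\<zeta> x) ^ k))" for x
    by (simp add: sum_product mult_ac)
  show "integrable M (\<lambda>x. (\<Sum>k\<in>D. c k * \<zeta> x ^ k) * cnj (\<Sum>k\<in>D. d k * \<zeta> x ^ k))"
    unfolding eq by (intro Bochner_Integration.integrable_sum integrable_mult_right int)
  have "(LINT x|M. (\<Sum>k\<in>D. c k * \<zeta> x ^ k) * cnj (\<Sum>k\<in>D. d k * \<zeta> x ^ k))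
      = (\<Sum>j\<in>D. \<Sum>k\<in>D. (c j * cnj (d k)) * (LINT x|M. \<zeta> x ^ j * cnj (\<zeta> x) ^ k))"
    unfolding eq by (simp add: Bochner_Integration.integral_sum int)
  also have "\<dots> = (\<Sum>j\<in>D. \<Sum>k\<in>D. if k = j then (c j * cnj (d j)) * (LINT x|M. \<zeta> x ^ j * cnj (\<zeta> x) ^ j) else 0)"
    by (intro sum.cong refl) (auto simp: off)
  also have "\<dots> = (\<Sum>k\<in>D. c k * cnj (d k) * complex_of_real (LINT x|M. cmod (\<zeta> x) ^ (2 * k)))"
    using D by (simp add: diag)
  finally show "(LINT x|M. (\<Sum>k\<in>D. c k * \<zeta> x ^ k) * cnj (\<Sum>k\<in>D. d k * \<zeta> x ^ k))
      = (\<Sum>k\<in>D. c k * cnj (d k) * complex_of_real (LINT x|M. cmod (\<zeta> x) ^ (2 * k)))" .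
qed

text \<open>With both factors equal, the diagonal expansion leaves squared coefficients times
  moments; the domination by \<open>m k\<close> cancels the normalization.\<close>

lemma nn_integral_moment_poly_le:
  assumes M: "moment_dominated M \<zeta> m" and D: "finite D"
  shows "(\<integral>\<^sup>+x. ennreal ((cmod (\<Sum>k\<in>D. a k / complex_of_real (sqrt (m k)) * \<zeta> x ^ k))\<^sup>2) \<partial>M)
    \<le> ennreal (\<Sum>k\<in>D. (cmod (a k))\<^sup>2)"
proof -
  define c where "c = (\<lambda>k. a k / complex_of_real (sqrt (m k)))"
  have m: "0 < m k" "(LINT x|M. cmod (\<zeta> x) ^ (2 * k)) \<le> m k" for k
    using M by (auto simp: moment_dominated_def)
  note exp = moment_product_expansion[OF M D, of c c]
  have int: "integrable M (\<lambda>x. (cmod (\<Sum>k\<in>D. c k * \<zeta> x ^ k))\<^sup>2)"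
    using exp(1) unfolding complex_norm_square[symmetric] complex_of_real_integrable_eq .
  have "complex_of_real (LINT x|M. (cmod (\<Sum>k\<in>D. c k * \<zeta> x ^ k))\<^sup>2)
      = complex_of_real (\<Sum>k\<in>D. (cmod (c k))\<^sup>2 * (LINT x|M. cmod (\<zeta> x) ^ (2 * k)))"
    using exp(2) unfolding complex_norm_square[symmetric] integral_complex_of_real by simp
  then have "(LINT x|M. (cmod (\<Sum>k\<in>D. c k * \<zeta> x ^ k))\<^sup>2)
      = (\<Sum>k\<in>D. (cmod (c k))\<^sup>2 * (LINT x|M. cmod (\<zeta> x) ^ (2 * k)))" by (simp only: of_real_eq_iff)
  also have "\<dots> \<le> (\<Sum>k\<in>D. (cmod (c k))\<^sup>2 * m k)"
    by (intro sum_mono mult_left_mono m) simp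
  also have "\<dots> = (\<Sum>k\<in>D. (cmod (a k))\<^sup>2)"
  proof (intro sum.cong refl)
    fix k
    show "(cmod (c k))\<^sup>2 * m k = (cmod (a k))\<^sup>2"
      using m(1)[of k] by (simp add: c_def norm_divide power_divide)
  qed
  finally have "ennreal (LINT x|M. (cmod (\<Sum>k\<in>D. c k * \<zeta> x ^ k))\<^sup>2) \<le> ennreal (\<Sum>k\<in>D. (cmod (a k))\<^sup>2)"
    by (rule ennreal_leI)
  then show ?thesis by (subst (asm) nn_integral_eq_integral[OF int, symmetric]) (auto simp: c_def)
qed

lemma borel_measurable_psum [measurable]:
  assumes [measurable]: "\<zeta> \<in> borel_measurable M"
  shows "(\<lambda>x. psum m a n (\<zeta> x)) \<in> borel_measurable M"
  unfolding psum_def by measurable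

lemma borel_measurable_psum_prod [measurable]:
  assumes [measurable]: "\<zeta> \<in> borel_measurable M"
  shows "(\<lambda>x. psum_prod m a b n (\<zeta> x)) \<in> borel_measurable M"
proof -
  have [measurable]: "cnj \<in> borel_measurable borel"
    by (intro borel_measurable_continuous_onI continuous_intros)
  show ?thesis unfolding psum_prod_def by measurable
qed

section \<open>Convergence in L1 of the products of partial sums\<close>

context
  fixes M :: "'a measure" and \<zeta> :: "'a \<Rightarrow> complex" and m :: "nat \<Rightarrow> real" and a b :: "nat \<Rightarrow> complex"
  assumes M: "moment_dominated M \<zeta> m"
    and a: "summable (\<lambda>k. (cmod (a k))\<^sup>2)" and b: "summable (\<lambda>k. (cmod (b k))\<^sup>2)"
begin

lemma measurable_zeta: "\<zeta> \<in> borel_measurable M"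
  using M by (simp add: moment_dominated_def)

lemma nn_integral_psum_diff_le:
  assumes c: "summable (\<lambda>k. (cmod (c k))\<^sup>2)" and "N \<le> n"
  shows "(\<integral>\<^sup>+x. ennreal ((cmod (psum m c n (\<zeta> x) - psum m c N (\<zeta> x)))\<^sup>2) \<partial>M) \<le> ennreal ((l2tail c N)\<^sup>2)"
proof -
  have "psum m c n z - psum m c N z = (\<Sum>k\<in>{N..<n}. c k / complex_of_real (sqrt (m k)) * z ^ k)" for z
    using sum_diff_nat_ivl[of 0 N n "\<lambda>k. c k / complex_of_real (sqrt (m k)) * z ^ k"] \<open>N \<le> n\<close>
    by (simp add: psum_def atLeast0LessThan)
  then show ?thesis
    using nn_integral_moment_poly_le[OF M, of "{N..<n}" c] sum_le_l2tail[OF c, of N n]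
    by (auto intro: order_trans ennreal_leI)
qed

lemma nn_integral_psum_le:
  assumes c: "summable (\<lambda>k. (cmod (c k))\<^sup>2)"
  shows "(\<integral>\<^sup>+x. ennreal ((cmod (psum m c n (\<zeta> x)))\<^sup>2) \<partial>M) \<le> ennreal ((l2tail c 0)\<^sup>2)"
  using nn_integral_psum_diff_le[OF c, of 0 n] by (simp add: psum_def)

text \<open>Cauchy-Schwarz is applied to each term of the splitting behind \<open>prod_tail\<close>.
  The bound depends on the coefficients and on \<open>N\<close> only, not on \<open>n\<close>,
  \<open>M\<close> or \<open>\<zeta>\<close>; this uniformity drives the limits below.\<close>

lemma nn_integral_psum_prod_diff_le:
  assumes "N \<le> n"
  shows "(\<integral>\<^sup>+x. ennreal (cmod (psum_prod m a b n (\<zeta> x) - psum_prod m a b N (\<zeta> x))) \<partial>M)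
    \<le> ennreal (prod_tail a b N)"
proof -
  note [measurable] = measurable_zeta
  let ?A = "\<lambda>n x. psum m a n (\<zeta> x)" and ?B = "\<lambda>n x. psum m b n (\<zeta> x)"
  have [measurable]: "cnj \<in> borel_measurable borel"
    by (intro borel_measurable_continuous_onI continuous_intros)
  have nonneg: "0 \<le> l2tail a k" "0 \<le> l2tail b k" for k using l2tail_nonneg a b by auto
  have "cmod (psum_prod m a b n (\<zeta> x) - psum_prod m a b N (\<zeta> x))
      \<le> cmod ((?A n x - ?A N x) * cnj (?B n x)) + cmod (?A N x * cnj (?B n x - ?B N x))" for x
  proof -
    have eq: "psum_prod m a b n (\<zeta> x) - psum_prod m a b N (\<zeta> x)
        = (?A n x - ?A N x) * cnj (?B n x) + ?A N x * cnj (?B n x - ?B N x)"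
      by (simp add: psum_prod_def algebra_simps)
    show ?thesis unfolding eq by (rule norm_triangle_ineq)
  qed
  then have "(\<integral>\<^sup>+x. ennreal (cmod (psum_prod m a b n (\<zeta> x) - psum_prod m a b N (\<zeta> x))) \<partial>M)
      \<le> (\<integral>\<^sup>+x. ennreal (cmod ((?A n x - ?A N x) * cnj (?B n x)))
          + ennreal (cmod (?A N x * cnj (?B n x - ?B N x))) \<partial>M)"
    by (intro nn_integral_mono) (simp flip: ennreal_plus add: ennreal_leI)
  also have "\<dots> = (\<integral>\<^sup>+x. ennreal (cmod ((?A n x - ?A N x) * cnj (?B n x))) \<partial>M)
      + (\<integral>\<^sup>+x. ennreal (cmod (?A N x * cnj (?B n x - ?B N x))) \<partial>M)"
    by (intro nn_integral_add) measurable
  also have "\<dots> \<le> ennreal (l2tail a N * l2tail b 0) + ennreal (l2tail a 0 * l2tail b N)"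
    using nn_integral_psum_diff_le[OF a assms] nn_integral_psum_diff_le[OF b assms]
      nn_integral_psum_le[OF a] nn_integral_psum_le[OF b] nonneg
    by (intro add_mono nn_integral_Cauchy_Schwarz) (auto simp flip: complex_cnj_diff)
  also have "\<dots> = ennreal (prod_tail a b N)"
    using nonneg by (simp add: prod_tail_def ennreal_plus)
  finally show ?thesis .
qed

lemma integrable_psum_prod: "integrable M (\<lambda>x. psum_prod m a b n (\<zeta> x))"
  unfolding psum_prod_def psum_def
  using moment_product_expansion(1)[OF M finite_lessThan, of "\<lambda>k. a k / complex_of_real (sqrt (m k))" n
      "\<lambda>k. b k / complex_of_real (sqrt (m k))"] .

text \<open>The sequence is Cauchy in L1, hence a subsequence converges almost everywhere; its limit
  is \<open>g\<close>. The last property holds at every point of convergence, not only almost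
  everywhere, and later identifies \<open>g\<close> inside the disc.\<close>

lemma psum_prod_L1_limit:
  obtains g where "integrable M g"
    and "\<And>N. (\<integral>\<^sup>+x. ennreal (cmod (g x - psum_prod m a b N (\<zeta> x))) \<partial>M) \<le> ennreal (prod_tail a b N)"
    and "\<And>x y. (\<lambda>n. psum_prod m a b n (\<zeta> x)) \<longlonglongrightarrow> y \<Longrightarrow> g x = y"
proof -
  note [measurable] = measurable_zeta
  let ?s = "\<lambda>n x. psum_prod m a b n (\<zeta> x)"
  \<comment> \<open>The absolute value makes the right-hand side visibly nonnegative, as the return
    from \<open>ennreal\<close> to the reals requires.\<close>
  have diff: "(LINT x|M. cmod (?s n x - ?s N x)) \<le> \<bar>prod_tail a b N\<bar>" if "N \<le> n" for n N
  proof -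
    have "ennreal (LINT x|M. cmod (?s n x - ?s N x)) = (\<integral>\<^sup>+x. ennreal (cmod (?s n x - ?s N x)) \<partial>M)"
      by (intro nn_integral_eq_integral[symmetric] integrable_norm Bochner_Integration.integrable_diff
          integrable_psum_prod) simp
    also have "\<dots> \<le> ennreal \<bar>prod_tail a b N\<bar>"
      using nn_integral_psum_prod_diff_le[OF that] by (rule order_trans) (simp add: ennreal_leI)
    finally show ?thesis by simp
  qed
  have "\<exists>N. \<forall>i\<ge>N. \<forall>j\<ge>N. (LINT x|M. cmod (?s i x - ?s j x)) < e" if "0 < e" for e
  proof -
    have "\<forall>\<^sub>F N in sequentially. \<bar>prod_tail a b N\<bar> < e"
      using tendstoD[OF prod_tail_tendsto_0[OF a b] that] by simp
    then obtain N where N: "\<And>n. N \<le> n \<Longrightarrow> \<bar>prod_tail a b n\<bar> < e"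
      by (auto simp: eventually_sequentially)
    have "(LINT x|M. cmod (?s i x - ?s j x)) < e" if "N \<le> i" "N \<le> j" for i j
    proof (cases "j \<le> i")
      case True
      then show ?thesis using diff[of j i] N[of j] that by linarith
    next
      case False
      then show ?thesis using diff[of i j] N[of i] that by (simp add: norm_minus_commute)
    qed
    then show ?thesis by blast
  qed
  then obtain r where r: "strict_mono r" "AE x in M. Cauchy (\<lambda>i. ?s (r i) x)"
    using cauchy_L1_AE_cauchy_subseq[of M ?s] integrable_psum_prod by blast
  \<comment> \<open>A concrete pointwise limit, whose value is unspecified where the subsequence
    diverges.\<close>
  define g where "g = (\<lambda>x. lim (\<lambda>i. ?s (r i) x))"
  have [measurable]: "g \<in> borel_measurable M"
    unfolding g_def by (rule borel_measurable_lim_metric) simp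
  have lim: "AE x in M. (\<lambda>i. ?s (r i) x) \<longlonglongrightarrow> g x"
    using r(2) by eventually_elim (simp add: g_def Cauchy_convergent_iff convergent_LIMSEQ_iff)
  have le: "(\<integral>\<^sup>+x. ennreal (cmod (g x - ?s N x)) \<partial>M) \<le> ennreal (prod_tail a b N)" for N
  proof (rule nn_integral_norm_diff_limit[OF _ _ lim, where N = N])
    fix n assume "N \<le> n"
    then show "(\<integral>\<^sup>+x. ennreal (cmod (?s (r n) x - ?s N x)) \<partial>M) \<le> ennreal (prod_tail a b N)"
      using seq_suble[OF r(1), of n] by (intro nn_integral_psum_prod_diff_le) simp
  qed simp_all
  have "integrable M g"
  proof (rule integrableI_bounded)
    have "(\<integral>\<^sup>+x. ennreal (norm (g x)) \<partial>M) \<le> ennreal (prod_tail a b 0)"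
      using le[of 0] by (simp add: psum_prod_def psum_def)
    then show "(\<integral>\<^sup>+x. ennreal (norm (g x)) \<partial>M) < \<infinity>"
      by (rule order_le_less_trans) simp
  qed simp
  moreover have "g x = y" if "(\<lambda>n. ?s n x) \<longlonglongrightarrow> y" for x y
    using LIMSEQ_subseq_LIMSEQ[OF that r(1)] by (simp add: g_def limI comp_def)
  ultimately show ?thesis using that le by blast
qed

text \<open>L1 convergence allows the exchange of limit and integral. Here the diagonal moments
  equal \<open>m k\<close>, so the integrals of the products are exactly the partial sums of the
  series for \<open>S\<close>.\<close>

lemma integral_L1_limit:
  assumes g: "integrable M g"
    and le: "\<And>N. (\<integral>\<^sup>+x. ennreal (cmod (g x - psum_prod m a b N (\<zeta> x))) \<partial>M) \<le> ennreal (prod_tail a b N)"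
    and m: "\<And>k. (LINT x|M. cmod (\<zeta> x) ^ (2 * k)) = m k"
    and S: "(\<lambda>k. a k * cnj (b k)) sums S"
  shows "(LINT x|M. g x) = S"
proof -
  have "(LINT x|M. psum_prod m a b n (\<zeta> x)) = (\<Sum>k<n. a k * cnj (b k))" for n
  proof -
    have "0 < m k" for k using M by (simp add: moment_dominated_def)
    then have "complex_of_real (sqrt (m k)) * complex_of_real (sqrt (m k)) = complex_of_real (m k)"
      "complex_of_real (m k) \<noteq> 0" for k
      by (simp_all flip: of_real_mult add: less_imp_le less_imp_neq[symmetric])
    then show ?thesis
      unfolding psum_prod_def psum_def
        moment_product_expansion(2)[OF M finite_lessThan, of "\<lambda>k. a k / complex_of_real (sqrt (m k))" n
          "\<lambda>k. b k / complex_of_real (sqrt (m k))"]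
      by (simp add: m)
  qed
  moreover have "(\<lambda>n. LINT x|M. psum_prod m a b n (\<zeta> x)) \<longlonglongrightarrow> (LINT x|M. g x)"
  proof (rule tendsto_L1_int[OF integrable_psum_prod g])
    have "(\<lambda>n. ennreal (prod_tail a b n)) \<longlonglongrightarrow> ennreal 0"
      by (intro tendsto_ennrealI prod_tail_tendsto_0 a b)
    then have lim: "(\<lambda>n. ennreal (prod_tail a b n)) \<longlonglongrightarrow> 0" by simp
    show "(\<lambda>n. \<integral>\<^sup>+x. ennreal (norm (psum_prod m a b n (\<zeta> x) - g x)) \<partial>M) \<longlonglongrightarrow> 0"
      by (rule tendsto_sandwich[OF _ _ tendsto_const lim])
        (simp_all add: norm_minus_commute[of _ "g _"] le)
  qed
  ultimately have "(\<lambda>n. \<Sum>k<n. a k * cnj (b k)) \<longlonglongrightarrow> (LINT x|M. g x)" by simp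
  then show ?thesis using S unfolding sums_def by (rule LIMSEQ_unique)
qed

end

section \<open>Orthogonality of monomials in the plane\<close>

abbreviation angle :: "real measure" where
  "angle \<equiv> restrict_space lborel {0..<2 * pi}"

lemma measurable_polar [measurable]:
  assumes "sets M = sets (borel :: real measure)" "N = angle"
  shows "(\<lambda>(r, \<theta>). complex_of_real r * cis \<theta>) \<in> borel_measurable (M \<Otimes>\<^sub>M N)"
proof -
  have [measurable]: "cis \<in> borel_measurable borel"
    by (intro borel_measurable_continuous_onI continuous_intros)
  have [measurable]: "fst \<in> borel_measurable (M \<Otimes>\<^sub>M N)"
    using measurable_fst[of M N] assms(1) by (simp cong: measurable_cong_sets)
  have "(\<lambda>x. x) \<in> borel_measurable N" unfolding assms(2) by (rule measurable_restrict_space1) simp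
  then have [measurable]: "snd \<in> borel_measurable (M \<Otimes>\<^sub>M N)"
    using measurable_compose[OF measurable_snd] by blast
  show ?thesis unfolding case_prod_beta by measurable
qed

text \<open>For a nonzero integer frequency the exponential has an antiderivative of period
  \<open>2 * pi\<close>.\<close>

lemma integral_cis_power:
  assumes "j \<noteq> k"
  shows "(LINT \<theta>|angle. cis \<theta> ^ j * cnj (cis \<theta>) ^ k) = 0"
proof -
  define n where "n = real j - real k"
  have n: "n \<noteq> 0" using assms by (simp add: n_def)
  have eq: "cis \<theta> ^ j * cnj (cis \<theta>) ^ k = cis (n * \<theta>)" for \<theta>
    unfolding cis_cnj Complex.DeMoivre cis_mult by (simp add: n_def algebra_simps)
  have "(LINT \<theta>|angle. cis \<theta> ^ j * cnj (cis \<theta>) ^ k)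
      = (LINT \<theta>|lborel. indicator {0..<2 * pi} \<theta> *\<^sub>R cis (n * \<theta>))"
    unfolding eq by (rule integral_restrict_space) simp
  \<comment> \<open>The fundamental theorem of calculus is applied on a closed interval; the
    endpoint added here is a null set.\<close>
  also have "\<dots> = (LINT \<theta>|lborel. indicator {0..2 * pi} \<theta> *\<^sub>R cis (n * \<theta>))"
  proof (rule integral_cong_AE)
    have [measurable]: "(\<lambda>\<theta>. cis (n * \<theta>)) \<in> borel_measurable borel"
      by (intro borel_measurable_continuous_onI continuous_intros)
    show "(\<lambda>\<theta>. indicator {0..<2 * pi} \<theta> *\<^sub>R cis (n * \<theta>)) \<in> borel_measurable lborel"
      "(\<lambda>\<theta>. indicator {0..2 * pi} \<theta> *\<^sub>R cis (n * \<theta>)) \<in> borel_measurable lborel" by measurable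
    show "AE \<theta> in lborel. indicator {0..<2 * pi} \<theta> *\<^sub>R cis (n * \<theta>)
        = indicator {0..2 * pi} \<theta> *\<^sub>R cis (n * \<theta>)"
      using AE_lborel_singleton[of "2 * pi"] by eventually_elim (auto simp: indicator_def)
  qed
  also have "\<dots> = cis (n * (2 * pi)) / (\<i> * n) - cis (n * 0) / (\<i> * n)"
  proof (rule integral_FTC_Icc)
    fix \<theta> :: real
    have "((\<lambda>w. exp (\<i> * (complex_of_real n * w)) / (\<i> * complex_of_real n)) has_field_derivative
        exp (\<i> * (complex_of_real n * complex_of_real \<theta>))) (at (complex_of_real \<theta>))"
      using n by (auto intro!: derivative_eq_intros simp: mult_ac)
    from has_vector_derivative_real_field[OF this, of "{0..2 * pi}"]
    show "((\<lambda>\<theta>. cis (n * \<theta>) / (\<i> * n)) has_vector_derivative cis (n * \<theta>)) (at \<theta> within {0..2 * pi})"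
      by (simp add: cis_conv_exp)
  qed (auto intro!: continuous_intros)
  also have "cis (n * (2 * pi)) = 1"
  proof -
    have "cis (n * (2 * pi)) = cis (2 * pi * real_of_int (int j - int k))" by (simp add: n_def mult.commute)
    also have "\<dots> = 1" by (rule cis_multiple_2pi) simp
    finally show ?thesis .
  qed
  finally show ?thesis by simp
qed

section \<open>The radial and planar measures and their moments\<close>

lemma node_bounds:
  assumes "0 < q" "q < 1"
  shows "0 < node q n" "(1 - q) * (node q n)\<^sup>2 \<le> 1"
  using assms node_power_even[OF assms, of n 1] by (auto simp: node_def power_le_one)

lemma sets_rho: "sets (rho q \<alpha>) = sets borel"
  by (simp add: rho_def)

text \<open>Turns the scaling into a constant density, so that the integration rules for densities
  and image measures apply.\<close>

lemma planar_eq_density: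
  "planar q \<alpha> = density (distr (rho q \<alpha> \<Otimes>\<^sub>M angle) borel
       (\<lambda>(r, \<theta>). complex_of_real r * cis \<theta>)) (\<lambda>_. ennreal (1 / (2 * pi)))"
  by (rule measure_eqI) (simp_all add: planar_def emeasure_density_const)

lemma sets_planar: "sets (planar q \<alpha>) = sets borel"
  by (simp add: planar_def)

lemma space_planar: "space (planar q \<alpha>) = UNIV"
  by (simp add: planar_def space_scale_measure)

lemma Ccircle_sets: "Ccircle q \<in> sets borel" and Cdisc_sets: "Cdisc q \<in> sets borel"
  unfolding Ccircle_def Cdisc_def by measurable

context
  fixes q \<alpha> :: real
  assumes q: "0 < q" "q < 1" and \<alpha>: "-1 < \<alpha>" "\<alpha> < q"
begin

interpretation M2: finite_measure angle
  by (rule finite_measureI) (simp add: emeasure_restrict_space space_restrict_space)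

abbreviation polar :: "(real \<times> real) measure" where
  "polar \<equiv> rho q \<alpha> \<Otimes>\<^sub>M angle"

text \<open>Integrals against \<open>rho\<close> are series over the nodes; nonnegative weights turn
  the convergence of the moment series into absolute convergence, that is, integrability.\<close>

lemma integrable_rho_power: "integrable (rho q \<alpha>) (\<lambda>r. r ^ (2 * k))"
  and integral_rho_power: "(LINT r|rho q \<alpha>. r ^ (2 * k)) = xfact q \<alpha> k"
proof -
  have w: "0 \<le> weight q \<alpha> n" for n using weight_nonneg q \<alpha> by blast
  note sums = weight_moments[OF q \<alpha>, of k]
  have int: "integrable (count_space UNIV) (\<lambda>n. weight q \<alpha> n * node q n ^ (2 * k))"
    using sums_summable[OF sums] w by (simp add: integrable_count_space_nat_iff power_mult abs_mult)
  then show "integrable (rho q \<alpha>) (\<lambda>r. r ^ (2 * k))"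
    using w by (simp add: rho_def integrable_distr_eq integrable_real_density)
  have "(LINT n|count_space UNIV. weight q \<alpha> n * node q n ^ (2 * k)) = xfact q \<alpha> k"
    using sums_integral_count_space_nat[OF int] sums by (rule sums_unique2)
  then show "(LINT r|rho q \<alpha>. r ^ (2 * k)) = xfact q \<alpha> k"
    using w by (simp add: rho_def integral_distr integral_real_density)
qed

interpretation rho: finite_measure "rho q \<alpha>"
proof (rule finite_measureI)
  have "integrable (rho q \<alpha>) (\<lambda>r. 1 :: real)" using integrable_rho_power[of 0] by simp
  then show "emeasure (rho q \<alpha>) (space (rho q \<alpha>)) \<noteq> \<infinity>"
    by (simp add: integrable_iff_bounded less_top[symmetric])
qed

interpretation P: pair_sigma_finite "rho q \<alpha>" angle ..

lemma AE_rho: "AE r in rho q \<alpha>. 0 < r \<and> (1 - q) * r\<^sup>2 \<le> 1"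
  unfolding rho_def using node_bounds[OF q] by (subst AE_distr_iff) (auto simp: AE_density)

lemma integrable_planar_iff:
  fixes f :: "complex \<Rightarrow> 'b::{banach, second_countable_topology}"
  assumes [measurable]: "f \<in> borel_measurable borel"
  shows "integrable (planar q \<alpha>) f \<longleftrightarrow> integrable polar (\<lambda>x. f (complex_of_real (fst x) * cis (snd x)))"
proof -
  have [simp]: "integrable M (\<lambda>x. (1 / (2 * pi)) *\<^sub>R g x) \<longleftrightarrow> integrable M g"
    for M :: "(real \<times> real) measure" and g :: "real \<times> real \<Rightarrow> 'b"
    using integrable_scaleR_right[of "2 * pi" M "\<lambda>x. (1 / (2 * pi)) *\<^sub>R g x"] by auto
  show ?thesis
    unfolding planar_eq_density using measurable_polar[OF sets_rho refl]
    by (simp add: integrable_density integrable_distr_eq case_prod_beta')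
qed

lemma integral_planar:
  fixes f :: "complex \<Rightarrow> 'b::{banach, second_countable_topology}"
  assumes [measurable]: "f \<in> borel_measurable borel"
  shows "(LINT z|planar q \<alpha>. f z) = (1 / (2 * pi)) *\<^sub>R
    (LINT x|polar. f (complex_of_real (fst x) * cis (snd x)))"
  unfolding planar_eq_density using measurable_polar[OF sets_rho refl]
  by (simp add: integral_density integral_distr case_prod_beta')

lemma finite_measure_planar: "finite_measure (planar q \<alpha>)"
proof (rule finite_measureI)
  interpret PP: finite_measure polar
    by (intro finite_measure_pair_measure) unfold_locales
  have "integrable (planar q \<alpha>) (\<lambda>_. 1 :: real)" by (simp add: integrable_planar_iff)
  then show "emeasure (planar q \<alpha>) (space (planar q \<alpha>)) \<noteq> \<infinity>"
    by (simp add: integrable_iff_bounded less_top[symmetric])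
qed

text \<open>All atoms of \<open>rho\<close> satisfy \<open>node_bounds\<close>, and the angle does
  not change the modulus.\<close>

lemma AE_planar: "AE z in planar q \<alpha>. (1 - q) * (cmod z)\<^sup>2 \<le> 1"
proof -
  have m: "(\<lambda>(r, \<theta>). complex_of_real r * cis \<theta>) \<in>
      polar \<rightarrow>\<^sub>M borel"
    by (rule measurable_polar[OF sets_rho refl])
  have "AE x in polar.
      (1 - q) * (cmod (case x of (r, \<theta>) \<Rightarrow> complex_of_real r * cis \<theta>))\<^sup>2 \<le> 1"
  proof (rule P.AE_pair_measure)
    show "{x \<in> space polar.
        (1 - q) * (cmod (case x of (r, \<theta>) \<Rightarrow> complex_of_real r * cis \<theta>))\<^sup>2 \<le> 1}
        \<in> sets polar"
      using m by measurable
    show "AE r in rho q \<alpha>. AE \<theta> in angle.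
        (1 - q) * (cmod (case (r, \<theta>) of (r, \<theta>) \<Rightarrow> complex_of_real r * cis \<theta>))\<^sup>2 \<le> 1"
      using AE_rho by eventually_elim (simp add: norm_mult)
  qed
  then show ?thesis
    unfolding planar_eq_density by (simp add: AE_density AE_distr_iff[OF m])
qed

lemma integrable_planar_bounded:
  fixes f :: "complex \<Rightarrow> 'b::{banach, second_countable_topology}"
  assumes "f \<in> borel_measurable borel" "\<And>z. (1 - q) * (cmod z)\<^sup>2 \<le> 1 \<Longrightarrow> norm (f z) \<le> B"
  shows "integrable (planar q \<alpha>) f"
proof -
  interpret finite_measure "planar q \<alpha>" by (rule finite_measure_planar)
  show ?thesis
    using AE_planar assms
    by (intro integrable_const_bound[of _ B]) (auto simp: measurable_cong_sets[OF sets_planar refl])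
qed

lemma cmod_le_node:
  assumes "(1 - q) * (cmod z)\<^sup>2 \<le> 1"
  shows "cmod z \<le> node q 0"
proof (rule power2_le_imp_le)
  have "(node q 0)\<^sup>2 = 1 / (1 - q)" using node_power_even[OF q, of 0 1] by simp
  then show "(cmod z)\<^sup>2 \<le> (node q 0)\<^sup>2" using assms q by (simp add: pos_le_divide_eq mult.commute)
qed (use node_bounds(1)[OF q] in \<open>simp add: less_imp_le\<close>)

text \<open>A cut-off depending on the modulus alone does not disturb the vanishing of the angular
  integral. The predicate \<open>Q\<close> covers the whole plane (constant \<open>True\<close>) and
  the boundary circle at once.\<close>

lemma integral_planar_monomials:
  assumes [measurable]: "Measurable.pred borel Q"
  shows "integrable (planar q \<alpha>) (\<lambda>z. indicator {z. Q (cmod z)} z *\<^sub>R (z ^ j * cnj z ^ k))"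
    and "j \<noteq> k \<Longrightarrow> (LINT z|planar q \<alpha>. indicator {z. Q (cmod z)} z *\<^sub>R (z ^ j * cnj z ^ k)) = 0"
proof -
  let ?f = "\<lambda>z. indicator {z. Q (cmod z)} z *\<^sub>R (z ^ j * cnj z ^ k)"
  have [measurable]: "cnj \<in> borel_measurable borel"
    by (intro borel_measurable_continuous_onI continuous_intros)
  have f [measurable]: "?f \<in> borel_measurable borel" by measurable
  show int: "integrable (planar q \<alpha>) ?f"
  proof (rule integrable_planar_bounded[OF f])
    fix z assume z: "(1 - q) * (cmod z)\<^sup>2 \<le> 1"
    have "norm (?f z) \<le> cmod z ^ (j + k)"
      by (simp add: norm_mult norm_power power_add indicator_def)
    also have "\<dots> \<le> node q 0 ^ (j + k)" using cmod_le_node[OF z] by (intro power_mono) auto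
    finally show "norm (?f z) \<le> node q 0 ^ (j + k)" .
  qed
  assume "j \<noteq> k"
  have "(LINT x|polar. ?f (complex_of_real (fst x) * cis (snd x)))
      = (LINT r|rho q \<alpha>. LINT \<theta>|angle. ?f (complex_of_real r * cis \<theta>))"
    using P.integral_fst'[OF int[unfolded integrable_planar_iff[OF f]]] by (simp only: fst_conv snd_conv)
  also have "\<dots> = (LINT r|rho q \<alpha>. LINT \<theta>|angle.
      ?f (complex_of_real r) * (cis \<theta> ^ j * cnj (cis \<theta>) ^ k))"
    by (intro Bochner_Integration.integral_cong refl)
      (simp add: norm_mult indicator_def power_mult_distrib)
  also have "\<dots> = 0" using integral_cis_power[OF \<open>j \<noteq> k\<close>] by simp
  finally show "(LINT z|planar q \<alpha>. ?f z) = 0" by (simp add: integral_planar)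
qed

lemma integrable_planar_cmod_power: "integrable (planar q \<alpha>) (\<lambda>z. cmod z ^ n)"
  using cmod_le_node by (intro integrable_planar_bounded[of _ "node q 0 ^ n"]) (auto intro: power_mono)

lemma integral_planar_cmod_power: "(LINT z|planar q \<alpha>. cmod z ^ (2 * k)) = xfact q \<alpha> k"
proof -
  have "(LINT x|polar. cmod (complex_of_real (fst x) * cis (snd x)) ^ (2 * k))
      = (LINT r|rho q \<alpha>. LINT \<theta>|angle. cmod (complex_of_real r * cis \<theta>) ^ (2 * k))"
  proof -
    have "integrable polar (\<lambda>x. cmod (complex_of_real (fst x) * cis (snd x)) ^ (2 * k))"
      using integrable_planar_cmod_power by (subst integrable_planar_iff[symmetric]) auto
    from P.integral_fst'[OF this] show ?thesis by (simp only: fst_conv snd_conv)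
  qed
  also have "\<dots> = (LINT r|rho q \<alpha>. 2 * pi * r ^ (2 * k))"
    by (intro Bochner_Integration.integral_cong refl)
      (simp add: norm_mult power_mult measure_restrict_space space_restrict_space)
  also have "\<dots> = 2 * pi * xfact q \<alpha> k" by (simp add: integral_rho_power)
  finally show ?thesis by (simp add: integral_planar)
qed

lemma moment_dominated_planar: "moment_dominated (planar q \<alpha>) (\<lambda>z. z) (xfact q \<alpha>)"
  using integral_planar_monomials[of "\<lambda>_. True"] integral_planar_cmod_power xfact_pos[OF q \<alpha>(1)]
  by (simp add: moment_dominated_def measurable_cong_sets[OF sets_planar refl])

text \<open>The circle is invariant under rotation, so orthogonality survives the restriction. The
  dilation multiplies monomials by powers of \<open>s\<close>, and for \<open>s\<close> at most 1
  both operations can only lower the diagonal moments: the same \<open>xfact q \<alpha>\<close>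
  dominates for every radius.\<close>

lemma moment_dominated_circle:
  assumes s: "0 \<le> s" "s \<le> 1"
  shows "moment_dominated (restrict_space (planar q \<alpha>) (Ccircle q)) (\<lambda>z. complex_of_real s * z) (xfact q \<alpha>)"
proof -
  let ?Q = "\<lambda>r. (1 - q) * r\<^sup>2 = 1"
  have C: "Ccircle q \<inter> space (planar q \<alpha>) \<in> sets (planar q \<alpha>)"
    using Ccircle_sets by (simp add: space_planar sets_planar)
  have eq: "indicator (Ccircle q) z *\<^sub>R ((complex_of_real s * z) ^ j * cnj (complex_of_real s * z) ^ k)
      = complex_of_real (s ^ (j + k)) * (indicator {z. ?Q (cmod z)} z *\<^sub>R (z ^ j * cnj z ^ k))" for z j k
    by (simp add: Ccircle_def power_mult_distrib power_add indicator_def)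
  have Q: "Measurable.pred borel ?Q" by measurable
  have "integrable (planar q \<alpha>)
      (\<lambda>z. indicator (Ccircle q) z *\<^sub>R ((complex_of_real s * z) ^ j * cnj (complex_of_real s * z) ^ k))" for j k
    unfolding eq by (intro integrable_mult_right integral_planar_monomials(1)[OF Q])
  moreover have "(LINT z|planar q \<alpha>.
      indicator (Ccircle q) z *\<^sub>R ((complex_of_real s * z) ^ j * cnj (complex_of_real s * z) ^ k)) = 0"
    if "j \<noteq> k" for j k
    unfolding eq integral_mult_right_zero integral_planar_monomials(2)[OF Q that] by simp
  moreover
  have "(LINT z|planar q \<alpha>. indicator (Ccircle q) z *\<^sub>R cmod (complex_of_real s * z) ^ (2 * k)) \<le> xfact q \<alpha> k" for k
    unfolding integral_planar_cmod_power[symmetric]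
  proof (rule integral_mono')
    show "indicator (Ccircle q) z *\<^sub>R cmod (complex_of_real s * z) ^ (2 * k) \<le> cmod z ^ (2 * k)" for z
    proof -
      have "cmod (complex_of_real s * z) \<le> 1 * cmod z"
        unfolding norm_mult using s by (intro mult_right_mono) auto
      then have "cmod (complex_of_real s * z) ^ (2 * k) \<le> cmod z ^ (2 * k)" by (intro power_mono) auto
      then show ?thesis by (simp add: indicator_def)
    qed
  qed (use integrable_planar_cmod_power in auto)
  moreover have "(\<lambda>z. complex_of_real s * z) \<in> borel_measurable (restrict_space (planar q \<alpha>) (Ccircle q))"
    by (intro measurable_restrict_space1) (simp add: measurable_cong_sets[OF sets_planar refl])
  ultimately show ?thesis
    unfolding moment_dominated_def integrable_restrict_space[OF C] integral_restrict_space[OF C]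
    using xfact_pos[OF q \<alpha>(1)] by blast
qed

end

section \<open>The coherent states\<close>

text \<open>The weight of \<open>mu\<close> is infinite on the circle, so it cannot be converted to
  a real density globally. Multiplying by the indicator of \<open>C\<close>, where \<open>w\<close>
  is finite, makes the conversion exact.\<close>

lemma density_indicator:
  fixes F :: "'a \<Rightarrow> complex"
  assumes [measurable]: "w \<in> borel_measurable M" "C \<in> sets M" "F \<in> borel_measurable M"
    and fin: "\<And>x. x \<in> C \<Longrightarrow> w x < \<infinity>"
  shows "integrable (density M w) (\<lambda>x. indicator C x *\<^sub>R F x) \<longleftrightarrow>
      integrable M (\<lambda>x. indicator C x *\<^sub>R (enn2real (w x) *\<^sub>R F x))"
    and "(LINT x|density M w. indicator C x *\<^sub>R F x) = (LINT x|M. indicator C x *\<^sub>R (enn2real (w x) *\<^sub>R F x))"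
proof -
  have "density (density M w) (\<lambda>x. ennreal (indicator C x)) = density M (\<lambda>x. w x * ennreal (indicator C x))"
    by (rule density_density_eq) measurable
  \<comment> \<open>Outside \<open>C\<close> both densities are 0, by the convention that infinity
    times 0 is 0.\<close>
  also have "\<dots> = density M (\<lambda>x. ennreal (indicator C x * enn2real (w x)))"
    using fin by (intro density_cong) (auto simp: indicator_def)
  finally have eq: "density (density M w) (\<lambda>x. ennreal (indicator C x)) =
      density M (\<lambda>x. ennreal (indicator C x * enn2real (w x)))" .
  have "integrable (density M w) (\<lambda>x. indicator C x *\<^sub>R F x) \<longleftrightarrow>
      integrable (density (density M w) (\<lambda>x. ennreal (indicator C x))) F"
    by (intro integrable_density[symmetric]) auto
  also have "\<dots> \<longleftrightarrow> integrable M (\<lambda>x. (indicator C x * enn2real (w x)) *\<^sub>R F x)"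
    unfolding eq by (intro integrable_density) auto
  finally show "integrable (density M w) (\<lambda>x. indicator C x *\<^sub>R F x) \<longleftrightarrow>
      integrable M (\<lambda>x. indicator C x *\<^sub>R (enn2real (w x) *\<^sub>R F x))" by simp
  have "(LINT x|density M w. indicator C x *\<^sub>R F x) =
      (LINT x|density (density M w) (\<lambda>x. ennreal (indicator C x)). F x)"
    by (intro integral_density[symmetric]) auto
  also have "\<dots> = (LINT x|M. (indicator C x * enn2real (w x)) *\<^sub>R F x)"
    unfolding eq by (intro integral_density) auto
  finally show "(LINT x|density M w. indicator C x *\<^sub>R F x) =
      (LINT x|M. indicator C x *\<^sub>R (enn2real (w x) *\<^sub>R F x))" by simp
qed

text \<open>Uniform continuity of \<open>G\<close> on a closed ball makes the integrand uniformly
  small, and the measure is finite.\<close>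

lemma nn_integral_radial_diff:
  fixes G :: "complex \<Rightarrow> complex"
  assumes "finite_measure M" and R: "\<And>z. z \<in> space M \<Longrightarrow> cmod z \<le> R"
    and G: "continuous_on UNIV G" and e: "0 < e"
  shows "\<forall>\<^sub>F s in at_left 1. (\<integral>\<^sup>+z. ennreal (cmod (G (complex_of_real s * z) - G z)) \<partial>M) \<le> ennreal e"
proof -
  interpret finite_measure M by fact
  \<comment> \<open>The added 1 avoids division by 0 when the space has measure 0.\<close>
  define d where "d = e / (measure M (space M) + 1)"
  have d: "0 < d" using e measure_nonneg[of M "space M"] unfolding d_def by (intro divide_pos_pos) linarith+
  have "uniformly_continuous_on (cball 0 R) G"
    by (intro compact_uniformly_continuous continuous_on_subset[OF G]) auto
  then obtain \<delta> where \<delta>: "0 < \<delta>"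
    "\<And>x y. x \<in> cball 0 R \<Longrightarrow> y \<in> cball 0 R \<Longrightarrow> dist y x < \<delta> \<Longrightarrow> dist (G y) (G x) < d"
    using d unfolding uniformly_continuous_on_def by meson
  have "((\<lambda>s. (1 - s) * (\<bar>R\<bar> + 1)) \<longlongrightarrow> (1 - 1) * (\<bar>R\<bar> + 1)) (at_left (1 :: real))"
    by (intro tendsto_intros)
  then have "\<forall>\<^sub>F s in at_left (1 :: real). (1 - s) * (\<bar>R\<bar> + 1) < \<delta>"
    using \<delta>(1) by (intro order_tendstoD(2)) auto
  moreover have "\<forall>\<^sub>F s in at_left (1 :: real). s \<in> {0<..<1}" by (rule eventually_at_left_real) simp
  ultimately show ?thesis
  proof eventually_elim
    case (elim s)
    have "cmod (G (complex_of_real s * z) - G z) \<le> d" if z: "z \<in> space M" for z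
    proof -
      have "complex_of_real s * z - z = complex_of_real (s - 1) * z" by (simp add: algebra_simps)
      then have "dist (complex_of_real s * z) z = (1 - s) * cmod z"
        using elim by (simp add: dist_norm norm_mult del: of_real_diff)
      also have "\<dots> \<le> (1 - s) * (\<bar>R\<bar> + 1)" using R[OF z] elim by (intro mult_left_mono) auto
      finally have "dist (complex_of_real s * z) z < \<delta>" using elim by linarith
      moreover have "cmod (complex_of_real s * z) \<le> 1 * cmod z"
        unfolding norm_mult using elim by (intro mult_right_mono) auto
      ultimately show ?thesis
        using \<delta>(2)[of z "complex_of_real s * z"] R[OF z] by (simp add: dist_norm)
    qed
    then have "(\<integral>\<^sup>+z. ennreal (cmod (G (complex_of_real s * z) - G z)) \<partial>M) \<le> (\<integral>\<^sup>+z. ennreal d \<partial>M)"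
      by (intro nn_integral_mono ennreal_leI) auto
    also have "\<dots> = ennreal (d * measure M (space M))"
      using d by (simp add: emeasure_eq_measure ennreal_mult)
    also have "d * measure M (space M) \<le> d * (measure M (space M) + 1)"
      using d by (intro mult_left_mono) auto
    also have "d * (measure M (space M) + 1) = e"
    proof -
      have "measure M (space M) + 1 \<noteq> 0" using measure_nonneg[of M "space M"] by linarith
      then show ?thesis by (simp add: d_def)
    qed
    finally show ?case by (simp add: ennreal_leI)
  qed
qed

section \<open>Pointwise behaviour of the coherent states in the disc\<close>

lemma summable_norm_factor:
  assumes "0 < q" "q < 1" "-1 < \<alpha>" and t: "0 \<le> t" "(1 - q) * t < 1"
  shows "summable (\<lambda>n. t ^ n / xfact q \<alpha> n)"
proof (rule summable_suminf_not_top)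
  have "complex_of_real (sqrt t) \<in> Cdisc q" using t by (simp add: Cdisc_def)
  from norm_factor_finite(1)[OF assms(1-3) this]
  show "(\<Sum>n. ennreal (t ^ n / xfact q \<alpha> n)) \<noteq> top" using t by (simp add: norm_factor_def)
qed (use t xfact_pos[OF assms(1-3)] in \<open>simp add: less_imp_le\<close>)

text \<open>The term of index 0 is 1, which makes the sum strictly positive; finiteness in the disc
  keeps \<open>enn2real\<close> from returning its default value 0.\<close>

lemma enn2real_norm_factor_pos:
  assumes "0 < q" "q < 1" "-1 < \<alpha>" and z: "z \<in> Cdisc q"
  shows "0 < enn2real (norm_factor q \<alpha> ((cmod z)\<^sup>2))"
proof -
  have "summable (\<lambda>n. ((cmod z)\<^sup>2) ^ n / xfact q \<alpha> n)"
    using z by (intro summable_norm_factor assms(1-3)) (auto simp: Cdisc_def)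
  then have "0 < (\<Sum>n. ((cmod z)\<^sup>2) ^ n / xfact q \<alpha> n)"
    using xfact_pos[OF assms(1-3)]
    by (intro suminf_pos2[of _ 0]) (auto simp: less_imp_le)
  then show ?thesis using norm_factor_finite(2)[OF assms] by simp
qed

text \<open>
  Comparing \<open>z\<close> with a slightly larger radius makes the series of the coherent state absolutely
  convergent.
\<close>

lemma summable_coherent_coefficients:
  assumes q: "0 < q" "q < 1" "-1 < \<alpha>" and z: "z \<in> Cdisc q"
  shows "summable (\<lambda>n. cmod z ^ n / sqrt (xfact q \<alpha> n))"
proof -
  have pos: "0 < xfact q \<alpha> n" for n using xfact_pos q by blast
  have "(cmod z)\<^sup>2 < 1 / (1 - q)" using z q by (simp add: Cdisc_def field_simps)
  then obtain w where w: "(cmod z)\<^sup>2 < w" "w < 1 / (1 - q)" using dense by blast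
  have w0: "0 < w" using w(1) zero_le_power2[of "cmod z"] by linarith
  \<comment> \<open>The two summands are the squares of the factors \<open>x\<close> and
    \<open>y\<close> into which the term is split below;
    \<open>x * y \<le> x\<^sup>2 + y\<^sup>2\<close> gives the comparison.\<close>
  have "summable (\<lambda>n. ((cmod z)\<^sup>2 / w) ^ n + w ^ n / xfact q \<alpha> n)"
    using w w0 q by (intro summable_add summable_geometric summable_norm_factor) (auto simp: field_simps)
  then show ?thesis
  proof (rule summable_comparison_test')
    fix n
    have p: "(x ^ n)\<^sup>2 = (x\<^sup>2) ^ n" for x :: real by (metis mult.commute power_mult)
    define x where "x = cmod z ^ n / sqrt w ^ n"
    define y where "y = sqrt w ^ n / sqrt (xfact q \<alpha> n)"
    have "((cmod z)\<^sup>2 / w) ^ n = x\<^sup>2" "w ^ n / xfact q \<alpha> n = y\<^sup>2"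
      using w0 pos[of n] by (simp_all add: x_def y_def power_divide p)
    moreover have "cmod z ^ n / sqrt (xfact q \<alpha> n) = x * y" using w0 by (simp add: x_def y_def)
    moreover have "x * y \<le> x\<^sup>2 + y\<^sup>2"
    proof -
      have "0 \<le> x * y" using w0 pos[of n] by (simp add: x_def y_def)
      then show ?thesis using sum_squares_bound[of x y] by linarith
    qed
    ultimately have "cmod z ^ n / sqrt (xfact q \<alpha> n) \<le> ((cmod z)\<^sup>2 / w) ^ n + w ^ n / xfact q \<alpha> n"
      by simp
    then show "norm (cmod z ^ n / sqrt (xfact q \<alpha> n)) \<le> ((cmod z)\<^sup>2 / w) ^ n + w ^ n / xfact q \<alpha> n"
      using pos[of n] by (simp add: less_imp_le)
  qed
qed

text \<open>The state carries \<open>cnj z ^ n\<close>, so its unnormalized series gives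
  \<open>F v z\<close> when paired with \<open>v\<close> on the right and \<open>cnj (F u z)\<close>
  when paired with \<open>u\<close> on the left. The two factors \<open>1 / sqrt N\<close> cancel
  the normalization factor \<open>N\<close>.\<close>

lemma (in complex_hilbert_space) psum_prod_tendsto:
  assumes basis: "orthonormal_basis scaleC ip \<phi>"
    and q: "0 < q" "q < 1" "-1 < \<alpha>" and z: "z \<in> Cdisc q"
  shows "(\<lambda>n. psum_prod (xfact q \<alpha>) (\<lambda>k. ip (\<phi> k) v) (\<lambda>k. ip (\<phi> k) u) n z) \<longlonglongrightarrow>
    complex_of_real (enn2real (norm_factor q \<alpha> ((cmod z)\<^sup>2))) *
      ip u (rank_one scaleC ip (coherent_state scaleC \<phi> q \<alpha> z) v)"
proof -
  define N where "N = enn2real (norm_factor q \<alpha> ((cmod z)\<^sup>2))"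
  have N: "0 < N" unfolding N_def by (rule enn2real_norm_factor_pos[OF q z])
  have pos: "0 < xfact q \<alpha> n" for n using xfact_pos q by blast
  define f where "f = (\<lambda>n. scaleC (cnj z ^ n / complex_of_real (sqrt (xfact q \<alpha> n))) (\<phi> n))"
  have "norm (f n) = cmod z ^ n / sqrt (xfact q \<alpha> n)" for n
    using pos[of n] by (simp add: f_def norm_scaleC norm_basis[OF basis] norm_divide norm_power)
  then have "summable f"
    using summable_coherent_coefficients[OF q z] by (simp add: summable_norm_cancel)
  then have "f sums suminf f" by (rule summable_sums)
  then have "(\<lambda>n. ip x (f n)) sums ip x (suminf f)" for x
    by (rule bounded_linear.sums[OF bounded_linear_ip])
  moreover have "ip x (f n) = cnj (ip (\<phi> n) x / complex_of_real (sqrt (xfact q \<alpha> n)) * z ^ n)" for x n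
    using ip_commute[of "\<phi> n" x] by (simp add: f_def ip_scale_right)
  ultimately have lim: "(\<lambda>n. cnj (psum (xfact q \<alpha>) (\<lambda>k. ip (\<phi> k) x) n z)) \<longlonglongrightarrow> ip x (suminf f)" for x
    by (simp add: sums_def psum_def)
  have "(\<lambda>n. psum (xfact q \<alpha>) (\<lambda>k. ip (\<phi> k) v) n z) \<longlonglongrightarrow> ip (suminf f) v"
    using tendsto_cnj[OF lim[of v]] ip_commute[of v "suminf f"] by simp
  then have "(\<lambda>n. psum_prod (xfact q \<alpha>) (\<lambda>k. ip (\<phi> k) v) (\<lambda>k. ip (\<phi> k) u) n z) \<longlonglongrightarrow>
      ip (suminf f) v * ip u (suminf f)"
    unfolding psum_prod_def by (rule tendsto_mult[OF _ lim])
  also have "ip (suminf f) v * ip u (suminf f) = complex_of_real N *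
      ip u (rank_one scaleC ip (coherent_state scaleC \<phi> q \<alpha> z) v)"
  proof -
    have cs: "coherent_state scaleC \<phi> q \<alpha> z = scaleC (complex_of_real (1 / sqrt N)) (suminf f)"
      by (simp add: coherent_state_def N_def f_def)
    have "N * (1 / sqrt N * (1 / sqrt N)) = 1" using N by simp
    then have "complex_of_real N * (complex_of_real (1 / sqrt N) * complex_of_real (1 / sqrt N)) = 1"
      by (metis of_real_1 of_real_mult)
    then show ?thesis
      unfolding rank_one_def cs ip_scale_right ip_scale_left complex_cnj_complex_of_real
      by (metis (no_types, lifting) mult.assoc mult.left_commute mult_1)
  qed
  finally show ?thesis by (simp only: N_def)
qed

text \<open>The density of \<open>mu\<close> is absorbed into \<open>g\<close>, which reduces
  integrals over the disc to the finite measure \<open>planar q \<alpha>\<close>.\<close>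

lemma set_integral_mu_Cdisc:
  assumes q: "0 < q" "q < 1" and \<alpha>: "-1 < \<alpha>" "\<alpha> < q"
    and g: "g \<in> borel_measurable borel"
    and fg: "\<And>z. z \<in> Cdisc q \<Longrightarrow> g z = complex_of_real (enn2real (norm_factor q \<alpha> ((cmod z)\<^sup>2))) * f z"
  shows "set_integrable (mu q \<alpha>) (Cdisc q) f \<longleftrightarrow> set_integrable (planar q \<alpha>) (Cdisc q) g"
    and "(LINT z:Cdisc q|mu q \<alpha>. f z) = (LINT z:Cdisc q|planar q \<alpha>. g z)"
proof -
  let ?N = "\<lambda>z. norm_factor q \<alpha> ((cmod z)\<^sup>2)"
  \<comment> \<open>Nothing is known about the measurability of \<open>f\<close>; this quotient is
    measurable and agrees with \<open>f\<close> on the disc.\<close>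
  let ?F = "\<lambda>z. g z / complex_of_real (enn2real (?N z))"
  note [measurable_cong] = sets_planar[of q \<alpha>]
  have [measurable]: "?N \<in> borel_measurable borel" unfolding norm_factor_def by measurable
  have [measurable]: "Cdisc q \<in> sets borel" by (rule Cdisc_sets)
  note [measurable] = g
  have f: "indicator (Cdisc q) z *\<^sub>R f z = indicator (Cdisc q) z *\<^sub>R ?F z" for z
    using fg[of z] enn2real_norm_factor_pos[OF q \<alpha>(1), of z] by (auto simp: indicator_def)
  have G: "indicator (Cdisc q) z *\<^sub>R (enn2real (?N z) *\<^sub>R ?F z) = indicator (Cdisc q) z *\<^sub>R g z" for z
    using enn2real_norm_factor_pos[OF q \<alpha>(1), of z] by (auto simp: indicator_def scaleR_conv_of_real)
  have fin: "?N z < \<infinity>" if "z \<in> Cdisc q" for z by (rule norm_factor_finite(1)[OF q \<alpha>(1) that])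
  have m: "?N \<in> borel_measurable (planar q \<alpha>)" "Cdisc q \<in> sets (planar q \<alpha>)" "?F \<in> borel_measurable (planar q \<alpha>)"
    by measurable
  have "integrable (mu q \<alpha>) (\<lambda>z. indicator (Cdisc q) z *\<^sub>R ?F z) \<longleftrightarrow>
      integrable (planar q \<alpha>) (\<lambda>z. indicator (Cdisc q) z *\<^sub>R (enn2real (?N z) *\<^sub>R ?F z))"
    unfolding mu_def by (rule density_indicator(1)[OF m fin])
  then show "set_integrable (mu q \<alpha>) (Cdisc q) f \<longleftrightarrow> set_integrable (planar q \<alpha>) (Cdisc q) g"
    unfolding set_integrable_def f G .
  have "(LINT z|mu q \<alpha>. indicator (Cdisc q) z *\<^sub>R ?F z) =
      (LINT z|planar q \<alpha>. indicator (Cdisc q) z *\<^sub>R (enn2real (?N z) *\<^sub>R ?F z))"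
    unfolding mu_def by (rule density_indicator(2)[OF m fin])
  then show "(LINT z:Cdisc q|mu q \<alpha>. f z) = (LINT z:Cdisc q|planar q \<alpha>. g z)"
    unfolding set_lebesgue_integral_def f G .
qed

text \<open>Both \<open>h\<close> at the dilated point and \<open>g\<close> are compared with the
  \<open>N\<close>-th product of partial sums. The two errors are at most
  \<open>prod_tail a b N\<close> for every radius, so \<open>N\<close> can be fixed before
  \<open>s\<close>; the middle term then vanishes as \<open>s\<close> tends to 1 by
  \<open>nn_integral_radial_diff\<close>.\<close>

lemma radial_boundary_limit:
  assumes q: "0 < q" "q < 1" and \<alpha>: "-1 < \<alpha>" "\<alpha> < q"
    and a: "summable (\<lambda>k. (cmod (a k))\<^sup>2)" and b: "summable (\<lambda>k. (cmod (b k))\<^sup>2)"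
    and g [measurable]: "g \<in> borel_measurable borel"
    and le: "\<And>N. (\<integral>\<^sup>+z. ennreal (cmod (g z - psum_prod (xfact q \<alpha>) a b N z)) \<partial>planar q \<alpha>)
      \<le> ennreal (prod_tail a b N)"
    and h: "\<And>z. z \<in> Cdisc q \<Longrightarrow> (\<lambda>n. psum_prod (xfact q \<alpha>) a b n z) \<longlonglongrightarrow> h z"
  shows "((\<lambda>s. \<integral>\<^sup>+z\<in>Ccircle q. ennreal (cmod (h (complex_of_real s * z) - g z)) \<partial>planar q \<alpha>) \<longlongrightarrow> 0) (at_left 1)"
proof -
  let ?P = "psum_prod (xfact q \<alpha>) a b"
  note [measurable_cong] = sets_planar[of q \<alpha>]
  have [measurable]: "Ccircle q \<in> sets borel" by (rule Ccircle_sets)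
  have C: "Ccircle q \<inter> space (planar q \<alpha>) \<in> sets (planar q \<alpha>)" by (simp add: space_planar sets_planar)
  define M where "M = restrict_space (planar q \<alpha>) (Ccircle q)"
  have spM: "space M = Ccircle q" by (simp add: M_def space_restrict_space space_planar)
  have meas: "F \<in> borel_measurable M" if "F \<in> borel_measurable borel" for F :: "complex \<Rightarrow> complex"
    unfolding M_def using that
    by (intro measurable_restrict_space1) (simp add: measurable_cong_sets[OF sets_planar refl])
  have Pm [measurable]: "(\<lambda>z. ?P n (complex_of_real s * z)) \<in> borel_measurable M" for n s
    by (intro meas borel_measurable_psum_prod) measurable
  have Pm1 [measurable]: "?P n \<in> borel_measurable M" for n using Pm[of n 1] by simp
  have gm [measurable]: "g \<in> borel_measurable M" by (intro meas g)
  have fin: "finite_measure M"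
    unfolding M_def using finite_measure_planar[OF q \<alpha>] by (intro finite_measure_restrict_space) (simp_all add: sets_planar Ccircle_sets)
  have split: "(\<integral>\<^sup>+z. ennreal (cmod (h (complex_of_real s * z) - g z)) \<partial>M)
      \<le> ennreal (prod_tail a b N) +
        (\<integral>\<^sup>+z. ennreal (cmod (?P N (complex_of_real s * z) - ?P N z)) \<partial>M) + ennreal (prod_tail a b N)"
    if s: "0 < s" "s < 1" for s N
  proof -
    have sC: "complex_of_real s * z \<in> Cdisc q" if "z \<in> space M" for z
    proof -
      have "(1 - q) * (cmod (complex_of_real s * z))\<^sup>2 = s\<^sup>2 * ((1 - q) * (cmod z)\<^sup>2)"
        by (simp add: norm_mult power_mult_distrib)
      also have "\<dots> < 1"
        using that s power_Suc_less_one[of s 1] by (simp add: spM Ccircle_def numeral_2_eq_2)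
      finally show ?thesis by (simp add: Cdisc_def)
    qed
    \<comment> \<open>Measurability of \<open>h\<close> along the dilated circle is inherited from
      the pointwise limit of the products.\<close>
    have hm [measurable]: "(\<lambda>z. h (complex_of_real s * z)) \<in> borel_measurable M"
      by (rule borel_measurable_LIMSEQ_metric[OF Pm h[OF sC]])
    have "moment_dominated M (\<lambda>z. complex_of_real s * z) (xfact q \<alpha>)"
      unfolding M_def using s by (intro moment_dominated_circle q \<alpha>) auto
    note diff = nn_integral_psum_prod_diff_le[OF this a b]
    have 1: "(\<integral>\<^sup>+z. ennreal (cmod (h (complex_of_real s * z) - ?P N (complex_of_real s * z))) \<partial>M)
        \<le> ennreal (prod_tail a b N)"
      by (rule nn_integral_norm_diff_limit[where h = "\<lambda>n z. ?P n (complex_of_real s * z)", OF Pm Pm _ diff])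
        (use h[OF sC] in auto)
    have "(\<integral>\<^sup>+z. ennreal (cmod (g z - ?P N z)) \<partial>M) \<le> (\<integral>\<^sup>+z. ennreal (cmod (g z - ?P N z)) \<partial>planar q \<alpha>)"
      unfolding M_def nn_integral_restrict_space[OF C]
      by (intro nn_integral_mono) (simp add: indicator_def)
    then have 2: "(\<integral>\<^sup>+z. ennreal (cmod (g z - ?P N z)) \<partial>M) \<le> ennreal (prod_tail a b N)"
      using le by (rule order_trans)
    have tri: "cmod (x - w) \<le> cmod (x - y) + cmod (y - z) + cmod (w - z)" for x y z w :: complex
      using norm_triangle_ineq[of "x - y" "y - z"] norm_triangle_ineq4[of "x - z" "w - z"] by simp
    have "(\<integral>\<^sup>+z. ennreal (cmod (h (complex_of_real s * z) - g z)) \<partial>M)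
      \<le> (\<integral>\<^sup>+z. ennreal (cmod (h (complex_of_real s * z) - ?P N (complex_of_real s * z))) +
          ennreal (cmod (?P N (complex_of_real s * z) - ?P N z)) + ennreal (cmod (g z - ?P N z)) \<partial>M)"
      by (intro nn_integral_mono) (simp add: ennreal_leI tri flip: ennreal_plus)
    also have "\<dots> = (\<integral>\<^sup>+z. ennreal (cmod (h (complex_of_real s * z) - ?P N (complex_of_real s * z))) \<partial>M) +
        (\<integral>\<^sup>+z. ennreal (cmod (?P N (complex_of_real s * z) - ?P N z)) \<partial>M) +
        (\<integral>\<^sup>+z. ennreal (cmod (g z - ?P N z)) \<partial>M)"
      by (simp add: nn_integral_add)
    finally show ?thesis by (rule order_trans) (intro add_mono 1 2 order_refl)
  qed
  have "((\<lambda>s. \<integral>\<^sup>+z. ennreal (cmod (h (complex_of_real s * z) - g z)) \<partial>M) \<longlongrightarrow> 0) (at_left 1)"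
  proof (rule order_tendstoI)
    fix y :: ennreal assume "0 < y"
    obtain e where e: "0 < e" "ennreal e \<le> y"
    proof (cases y)
      case (real r)
      then show ?thesis using that[of r] \<open>0 < y\<close> by simp
    next
      case top
      then show ?thesis using that[of 1] by simp
    qed
    \<comment> \<open>Three terms of size \<open>e / 4\<close> sum to less than \<open>e\<close>,
      which gives the strict inequality that the order topology asks for.\<close>
    have "\<forall>\<^sub>F N in sequentially. prod_tail a b N < e / 4"
      using prod_tail_tendsto_0[OF a b] e by (intro order_tendstoD(2)) auto
    then obtain N where N: "prod_tail a b N < e / 4" by (auto simp: eventually_sequentially)
    have "cmod z \<le> node q 0" if "z \<in> space M" for z
      using that by (intro cmod_le_node[OF q \<alpha>]) (simp add: spM Ccircle_def)
    then have "\<forall>\<^sub>F s in at_left 1.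
        (\<integral>\<^sup>+z. ennreal (cmod (?P N (complex_of_real s * z) - ?P N z)) \<partial>M) \<le> ennreal (e / 4)"
      using e by (intro nn_integral_radial_diff[OF fin _ continuous_psum_prod]) auto
    moreover have "\<forall>\<^sub>F s in at_left (1 :: real). s \<in> {0<..<1}" by (rule eventually_at_left_real) simp
    ultimately show "\<forall>\<^sub>F s in at_left 1.
        (\<integral>\<^sup>+z. ennreal (cmod (h (complex_of_real s * z) - g z)) \<partial>M) < y"
    proof eventually_elim
      case (elim s)
      have "(\<integral>\<^sup>+z. ennreal (cmod (h (complex_of_real s * z) - g z)) \<partial>M)
          \<le> ennreal (e / 4) + ennreal (e / 4) + ennreal (e / 4)"
        using elim N by (intro order_trans[OF split[of s N]] add_mono ennreal_leI) auto
      also have "\<dots> = ennreal (3 * e / 4)" using e by (simp flip: ennreal_plus)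
      also have "\<dots> < ennreal e" using e by (intro ennreal_lessI) auto
      also have "\<dots> \<le> y" by (rule e)
      finally show ?case .
    qed
  qed simp
  then show ?thesis unfolding M_def nn_integral_restrict_space[OF C] .
qed

theorem proposition1:
  fixes scaleC :: "complex \<Rightarrow> 'h::banach \<Rightarrow> 'h"
    and ip :: "'h \<Rightarrow> 'h \<Rightarrow> complex"
    and \<phi> :: "nat \<Rightarrow> 'h"
    and q \<alpha> :: real
  assumes "complex_hilbert_space scaleC ip"
    and "orthonormal_basis scaleC ip \<phi>"
    and "0 < q" "q < 1"
    and "-1 < \<alpha>" "\<alpha> < q"
  shows "has_weak_mu_integral ip q \<alpha>
           (\<lambda>z. rank_one scaleC ip (coherent_state scaleC \<phi> q \<alpha> z)) id"
  unfolding has_weak_mu_integral_def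
proof (intro allI)
  fix u v :: 'h
  interpret complex_hilbert_space scaleC ip by fact
  note q = assms(3,4) and \<alpha> = assms(5,6) and basis = assms(2)
  let ?a = "\<lambda>k. ip (\<phi> k) v" and ?b = "\<lambda>k. ip (\<phi> k) u"
  let ?P = "psum_prod (xfact q \<alpha>) ?a ?b"
  let ?f = "\<lambda>z. ip u (rank_one scaleC ip (coherent_state scaleC \<phi> q \<alpha> z) v)"
  let ?h = "\<lambda>z. complex_of_real (enn2real (norm_factor q \<alpha> ((cmod z)\<^sup>2))) * ?f z"
  note dom = moment_dominated_planar[OF q \<alpha>]
  have a: "summable (\<lambda>k. (cmod (?a k))\<^sup>2)" and b: "summable (\<lambda>k. (cmod (?b k))\<^sup>2)"
    using summable_basis_coefficients[OF basis] by auto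
  have h: "(\<lambda>n. ?P n z) \<longlonglongrightarrow> ?h z" if "z \<in> Cdisc q" for z
    by (rule psum_prod_tendsto[OF basis q \<alpha>(1) that])
  obtain g where g: "integrable (planar q \<alpha>) g"
    and le: "\<And>N. (\<integral>\<^sup>+z. ennreal (cmod (g z - ?P N z)) \<partial>planar q \<alpha>) \<le> ennreal (prod_tail ?a ?b N)"
    and lim: "\<And>z y. (\<lambda>n. ?P n z) \<longlonglongrightarrow> y \<Longrightarrow> g z = y"
    using psum_prod_L1_limit[OF dom a b] by blast
  have gm: "g \<in> borel_measurable borel"
    using borel_measurable_integrable[OF g] by (simp add: measurable_cong_sets[OF sets_planar refl])
  \<comment> \<open>An equality at every point of the disc, since the products converge there;
    \<open>g\<close> can replace the weighted integrand without exceptional sets.\<close>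
  have gh: "g z = ?h z" if "z \<in> Cdisc q" for z by (rule lim[OF h[OF that]])
  have int: "set_integrable (planar q \<alpha>) A g" if "A \<in> sets borel" for A
    unfolding set_integrable_def using g that by (intro integrable_mult_indicator) (simp_all add: sets_planar)
  \<comment> \<open>The measure \<open>planar\<close> is carried by the closed disc, so its total
    integral splits into the open disc and the circle.\<close>
  have "(LINT z|planar q \<alpha>. g z) = (LINT z:Cdisc q \<union> Ccircle q|planar q \<alpha>. g z)"
    unfolding set_lebesgue_integral_def
  proof (rule integral_cong_AE)
    show "g \<in> borel_measurable (planar q \<alpha>)" using g by (rule borel_measurable_integrable)
    show "(\<lambda>z. indicator (Cdisc q \<union> Ccircle q) z *\<^sub>R g z) \<in> borel_measurable (planar q \<alpha>)"
      using int[of "Cdisc q \<union> Ccircle q"] Cdisc_sets Ccircle_sets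
      by (auto simp: set_integrable_def intro: borel_measurable_integrable)
    show "AE z in planar q \<alpha>. g z = indicator (Cdisc q \<union> Ccircle q) z *\<^sub>R g z"
      using AE_planar[OF q \<alpha>] by eventually_elim (auto simp: Cdisc_def Ccircle_def indicator_def)
  qed
  also have "\<dots> = (LINT z:Cdisc q|planar q \<alpha>. g z) + (LINT z:Ccircle q|planar q \<alpha>. g z)"
    by (intro set_integral_Un int Cdisc_sets Ccircle_sets) (auto simp: Cdisc_def Ccircle_def)
  \<comment> \<open>The moments of \<open>planar\<close> are equal to
    \<open>xfact q \<alpha> k\<close>, not merely dominated by it, so Parseval evaluates the total
    integral.\<close>
  also have "(LINT z|planar q \<alpha>. g z) = ip u v"
    by (rule integral_L1_limit[OF dom a b g le integral_planar_cmod_power[OF q \<alpha>] parseval[OF basis]])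
  finally have "ip u (id v) = (LINT z:Cdisc q|mu q \<alpha>. ?f z) + (LINT z:Ccircle q|planar q \<alpha>. g z)"
    using set_integral_mu_Cdisc(2)[OF q \<alpha> gm, of ?f] gh by simp
  moreover have "set_integrable (mu q \<alpha>) (Cdisc q) ?f"
    using set_integral_mu_Cdisc(1)[OF q \<alpha> gm, of ?f] gh int[OF Cdisc_sets] by simp
  moreover have "set_integrable (planar q \<alpha>) (Ccircle q) g" by (intro int Ccircle_sets)
  moreover note radial_boundary_limit[OF q \<alpha> a b gm le h]
  ultimately show "has_mu_integral q \<alpha> ?f (ip u (id v))"
    unfolding has_mu_integral_def by blast
qed

end
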